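(* Let $c>0$ be a constant and $p=c/n$. Let $\Delta$ denote the maximum degree of $G_{n,p}$. Then with high probability \[\tau_2(G_{n,p})=\left\lceil \frac{\sqrt{8\Delta+1}+5}{2}\right\rceil.\]
   Context: For a positive integer $t$ and a graph $G$, a (proper) $t$-tone $k$-coloring of $G$ is a function $f:V(G)\to\binom{[k]}{t}$ such that $|f(u)\cap f(v)|<d(u,v)$ for all distinct vertices $u,v$, where $d(u,v)$ is the graph distance. For $t=2$: adjacent vertices receive disjoint labels and vertices at distance $2$ receive distinct labels. $\tau_t(G)$ is the least $k$ for which a $t$-tone $k$-coloring exists. $G_{n,p}$ is the Erdős–Rényi random graph on $[n]$; "with high probability" means with probability $\to1$ as $n\to\infty$. *)

theory Defs
  imports Complex_Main "HOL-Library.Extended_Nat"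
begin

definition all_edges :: "nat \<Rightarrow> nat set set" where
  "all_edges n = {e. \<exists>u v. u < v \<and> v < n \<and> e = {u, v}}"

definition adj :: "nat set set \<Rightarrow> nat \<Rightarrow> nat \<Rightarrow> bool" where
  "adj E x y \<longleftrightarrow> x \<noteq> y \<and> {x, y} \<in> E"

definition gdist :: "nat set set \<Rightarrow> nat \<Rightarrow> nat \<Rightarrow> enat" where
  "gdist E u v = (if \<exists>k. (adj E ^^ k) u v
                  then enat (LEAST k. (adj E ^^ k) u v) else \<infinity>)"

definition degree :: "nat set set \<Rightarrow> nat \<Rightarrow> nat" where
  "degree E v = card {u. adj E u v}"

definition max_degree :: "nat \<Rightarrow> nat set set \<Rightarrow> nat" where
  "max_degree n E = Max (degree E ` {0..<n})"

definition tone_coloring :: "nat \<Rightarrow> nat \<Rightarrow> nat \<Rightarrow> nat set set \<Rightarrow> (nat \<Rightarrow> nat set) \<Rightarrow> bool" where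
  "tone_coloring t k n E f \<longleftrightarrow>
     (\<forall>v<n. f v \<subseteq> {1..k} \<and> card (f v) = t) \<and>
     (\<forall>u<n. \<forall>v<n. u \<noteq> v \<longrightarrow> enat (card (f u \<inter> f v)) < gdist E u v)"

definition tau :: "nat \<Rightarrow> nat \<Rightarrow> nat set set \<Rightarrow> nat" where
  "tau t n E = (LEAST k. \<exists>f. tone_coloring t k n E f)"

definition Gnp_prob :: "nat \<Rightarrow> real \<Rightarrow> (nat set set \<Rightarrow> bool) \<Rightarrow> real" where
  "Gnp_prob n p P = (\<Sum>E\<in>Pow (all_edges n).
      if P E then p ^ card E * (1 - p) ^ (card (all_edges n) - card E) else 0)"

end

(*
  Lower bound: at a vertex of degree D the labels of the neighbors are distinct 2-subsets of the
  k - 2 colors missing at the vertex, so D \<le> (k - 2) choose 2.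

  Upper bound: let L = ln n / ln (ln n), which is asymptotically the maximum degree, and call a vertex
  heavy if its degree is at least \<epsilon> L for a small constant \<epsilon>. First moment estimates show
  that with high probability every heavy vertex sees only trees within a bounded distance, that small trees
  have degree sum below 5/4 L, and that the graph is d-degenerate for a constant d depending only on c.
  Color greedily: first the heavy vertices together with their boundedly many neighbors that lie on
  short paths to other heavy vertices, then the other neighbors of heavy vertices u, which see no colored
  vertex except through u and hence at most \<Delta> - 1 forbidden labels, and finally all other vertices
  in a degeneracy order. In the last phase only about 13/20 L labels are forbidden, because the neighbors
  of v that are adjacent to heavy vertices form with these a tree in which they account for at
  most half of the degree sum.
*)
theory Submission
  imports Defs "HOL-Analysis.Elementary_Normed_Spaces" "HOL-Real_Asymp.Real_Asymp"
begin

text \<open>The formula is the least k with \<Delta> \<le> (k - 2) choose 2, and equality can occur,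
  so around a vertex of maximum degree there is no slack at all. A neighbor of a heavy vertex may
  therefore see one colored neighbor and \<Delta> - 1 forbidden labels, but nothing more. This is
  why the few neighbors with further conflicts are colored while almost all labels are still free.
  Everywhere else a constant proportion of slack suffices. The degree sums of small trees are below
  5/4 L and \<Delta> is at least 5/6 L; what matters is that half of the first constant is below the
  second. Half of 5/4 is 5/8, two error terms of L/100 keep the count below 13/20 L, and 13/20 =
  39/50 * 5/6. So in the last phase at most about 39/50 of (k - 2) choose 2 labels are forbidden,
  and losing boundedly many colors to neighbors is harmless for large k. Randomness enters the
  coloring only through deterministic conditions on edge counts and degrees. Trees and cycles are
  never formed as objects: they appear as connected sets T with at least |T| - 1 or at least |T|
  inner edges, which is what a first moment can bound.\<close>

section \<open>Connected vertex sets\<close>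

text \<open>Connectivity by cuts instead of paths: unions through a common vertex and the count of
  inner edges then follow without any walk.\<close>

definition connected_in :: "nat set set \<Rightarrow> nat set \<Rightarrow> bool" where
  "connected_in E Q \<longleftrightarrow> (\<forall>A\<subseteq>Q. A \<noteq> {} \<longrightarrow> A \<noteq> Q \<longrightarrow> (\<exists>a\<in>A. \<exists>b\<in>Q - A. adj E a b))"

definition inner_edges :: "nat set set \<Rightarrow> nat set \<Rightarrow> nat set set" where
  "inner_edges E Q = {e\<in>E. e \<subseteq> Q}"

lemma adj_sym: "adj E u v \<Longrightarrow> adj E v u"
  by (auto simp: adj_def insert_commute)

lemma not_adj_self [simp]: "\<not> adj E v v"
  by (simp add: adj_def)

lemma adj_bound:
  assumes "E \<subseteq> all_edges n" "adj E u v"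
  shows "u < n" "v < n"
proof -
  have "{u,v} \<in> all_edges n" using assms by (auto simp: adj_def)
  then show "u < n" "v < n" by (auto simp: all_edges_def doubleton_eq_iff)
qed

lemma finite_nbrs: "E \<subseteq> all_edges n \<Longrightarrow> finite {u. adj E v u}"
  by (rule finite_subset[of _ "{..<n}"]) (auto dest: adj_bound)

lemma degree_conv_adj: "degree E v = card {u. adj E v u}"
  unfolding degree_def by (intro arg_cong[of _ _ card]) (auto dest: adj_sym)

lemma finite_all_edges: "finite (all_edges n)"
proof -
  have "all_edges n \<subseteq> Pow {..<n}" by (auto simp: all_edges_def)
  then show ?thesis using finite_subset by blast
qed

lemma degree_le_max_degree:
  assumes "E \<subseteq> all_edges n" "v < n"
  shows "degree E v \<le> max_degree n E"
  unfolding max_degree_def using assms by (intro Max_ge) auto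

lemma connected_in_singleton: "connected_in E {v}"
  by (auto simp: connected_in_def)

text \<open>A part that no edge leaves meets each member of the family in nothing or in all of it,
  and the common vertex \<open>z\<close> makes the same alternative hold for all members.\<close>

lemma connected_in_Union:
  assumes "\<And>Q. Q \<in> \<Q> \<Longrightarrow> connected_in E Q" "\<And>Q. Q \<in> \<Q> \<Longrightarrow> z \<in> Q"
  shows "connected_in E (\<Union>\<Q>)"
  unfolding connected_in_def
proof (intro allI impI)
  fix A assume A: "A \<subseteq> \<Union>\<Q>" "A \<noteq> {}" "A \<noteq> \<Union>\<Q>"
  show "\<exists>a\<in>A. \<exists>b\<in>\<Union>\<Q> - A. adj E a b"
  proof (rule ccontr)
    assume no: "\<not> ?thesis"
    have "A \<inter> Q = {} \<or> A \<inter> Q = Q" if Q: "Q \<in> \<Q>" for Q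
    proof (rule ccontr)
      assume "\<not> ?thesis"
      then have "\<exists>a\<in>A \<inter> Q. \<exists>b\<in>Q - A \<inter> Q. adj E a b"
        using assms(1)[OF Q] unfolding connected_in_def by (metis inf_le2)
      then show False using no Q by blast
    qed
    then show False using A assms(2) by (cases "z \<in> A") blast+
  qed
qed

lemma connected_in_Un:
  assumes "connected_in E P" "connected_in E Q" "z \<in> P" "z \<in> Q"
  shows "connected_in E (P \<union> Q)"
  using connected_in_Union[of "{P,Q}" E z] assms by auto

lemma connected_in_insert:
  assumes "connected_in E Q" "x \<in> Q" "adj E x y"
  shows "connected_in E (insert y Q)"
proof -
  have "connected_in E {x,y}" unfolding connected_in_def
  proof (intro allI impI)
    fix A assume "A \<subseteq> {x,y}" "A \<noteq> {}" "A \<noteq> {x,y}"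
    then consider "A = {x}" "x \<noteq> y" | "A = {y}" "x \<noteq> y" by auto
    then show "\<exists>a\<in>A. \<exists>b\<in>{x,y} - A. adj E a b"
      using assms(3) adj_sym by cases auto
  qed
  then have "connected_in E (Q \<union> {x,y})" using connected_in_Un assms by blast
  moreover have "Q \<union> {x,y} = insert y Q" using assms by auto
  ultimately show ?thesis by simp
qed

lemma finite_inner_edges: "finite Q \<Longrightarrow> finite (inner_edges E Q)"
  by (rule finite_subset[of _ "Pow Q"]) (auto simp: inner_edges_def)

text \<open>This replaces a spanning tree: a subset is grown one vertex at a time along an edge that
  leaves it, and each step gains a new inner edge.\<close>

lemma connected_in_inner_edges:
  assumes "connected_in E Q" "finite Q"
  shows "card Q \<le> card (inner_edges E Q) + 1"
proof (cases "Q = {}")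
  case False
  have "\<exists>A\<subseteq>Q. card A = m \<and> m \<le> card (inner_edges E A) + 1"
    if "1 \<le> m" "m \<le> card Q" for m
    using that
  proof (induction m rule: dec_induct)
    case base
    obtain v where "v \<in> Q" using False by auto
    then show ?case by (intro exI[of _ "{v}"]) auto
  next
    case (step m)
    then obtain A where A: "A \<subseteq> Q" "card A = m" "m \<le> card (inner_edges E A) + 1" by auto
    then have "A \<noteq> {}" "A \<noteq> Q" using step by auto
    then obtain a b where ab: "a \<in> A" "b \<in> Q - A" "adj E a b"
      using assms(1) A unfolding connected_in_def by blast
    have fin: "finite A" using A assms(2) finite_subset by auto
    have "insert {a,b} (inner_edges E A) \<subseteq> inner_edges E (insert b A)"
      using ab by (auto simp: inner_edges_def adj_def)
    then have "card (insert {a,b} (inner_edges E A)) \<le> card (inner_edges E (insert b A))"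
      using fin by (intro card_mono finite_inner_edges) auto
    moreover have "{a,b} \<notin> inner_edges E A" using ab by (auto simp: inner_edges_def)
    ultimately have "card (inner_edges E A) + 1 \<le> card (inner_edges E (insert b A))"
      using finite_inner_edges[OF fin] by simp
    then show ?case using A ab fin by (intro exI[of _ "insert b A"]) auto
  qed
  from this[of "card Q"] obtain A where "A \<subseteq> Q" "card A = card Q" "card Q \<le> card (inner_edges E A) + 1"
    using False assms(2) by (metis Suc_leI card_gt_0_iff One_nat_def order_refl)
  then show ?thesis using assms(2) card_subset_eq by metis
qed simp

text \<open>Two edges from one new vertex into a connected set close a cycle. Only the resulting
  edge count is kept, since the hypothesis on short cycles speaks of nothing else.\<close>

lemma cycle_inner_edges:
  assumes "connected_in E T" "finite T" "v \<notin> T" "x \<in> T" "y \<in> T" "x \<noteq> y" "adj E v x" "adj E v y"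
  shows "card (insert v T) \<le> card (inner_edges E (insert v T))"
proof -
  have "card (inner_edges E T \<union> {{v,x},{v,y}}) \<le> card (inner_edges E (insert v T))"
    using assms by (intro card_mono finite_inner_edges) (auto simp: inner_edges_def adj_def)
  moreover have "card (inner_edges E T \<union> {{v,x},{v,y}}) = card (inner_edges E T) + card {{v,x},{v,y}}"
    using assms finite_inner_edges by (intro card_Un_disjoint) (auto simp: inner_edges_def)
  moreover have "card {{v,x},{v,y}} = 2" using assms by (auto simp: card_insert_if doubleton_eq_iff)
  ultimately show ?thesis using connected_in_inner_edges[OF assms(1,2)] assms by simp
qed

section \<open>Partial colorings\<close>

text \<open>Common neighbors range over the whole graph, not only over the colored set, so that a partial
  coloring remains valid when further vertices are colored.\<close>
definition partial_coloring :: "nat \<Rightarrow> nat set set \<Rightarrow> nat set \<Rightarrow> (nat \<Rightarrow> nat set) \<Rightarrow> bool" where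
  "partial_coloring k E C f \<longleftrightarrow>
     (\<forall>v\<in>C. f v \<subseteq> {1..k} \<and> card (f v) = 2) \<and>
     (\<forall>u\<in>C. \<forall>v\<in>C. u \<noteq> v \<longrightarrow>
        (adj E u v \<longrightarrow> f u \<inter> f v = {}) \<and> ((\<exists>x. adj E u x \<and> adj E v x) \<longrightarrow> f u \<noteq> f v))"

lemma partial_coloringD:
  assumes "partial_coloring k E C f" "u \<in> C"
  shows "f u \<subseteq> {1..k}" "card (f u) = 2"
    "v \<in> C \<Longrightarrow> adj E u v \<Longrightarrow> f u \<inter> f v = {}"
    "v \<in> C \<Longrightarrow> u \<noteq> v \<Longrightarrow> adj E u x \<Longrightarrow> adj E v x \<Longrightarrow> f u \<noteq> f v"
proof -
  show "f u \<inter> f v = {}" if "v \<in> C" "adj E u v"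
    using assms that by (cases "u = v") (simp, simp add: partial_coloring_def)
qed (use assms in \<open>unfold partial_coloring_def, blast+\<close>)

text \<open>The greedy step. Colored neighbors block at most \<open>2 * a\<close> colors, and each
  colored vertex that shares a neighbor with \<open>v\<close> blocks at most one 2-subset of the
  remaining colors. The truncated difference does no harm: for \<open>k < 2 * a\<close> the binomial
  is 0 and the last hypothesis fails.\<close>

lemma partial_coloring_extend:
  assumes f: "partial_coloring k E C f" and v: "v \<notin> C" and fin: "finite C"
    and a: "card {u\<in>C. adj E v u} \<le> a"
    and b: "card {u\<in>C. \<exists>x. adj E v x \<and> adj E u x} < (k - 2 * a) choose 2"
  shows "\<exists>g. partial_coloring k E (insert v C) g"
proof -
  define A where "A = {u\<in>C. adj E v u}"
  define B where "B = {u\<in>C. \<exists>x. adj E v x \<and> adj E u x}"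
  define X where "X = {1..k} - \<Union>(f ` A)"
  have finAB: "finite A" "finite B" using fin by (auto simp: A_def B_def)
  have A2: "card (f u) = 2" if "u \<in> A" for u using f that by (auto simp: partial_coloring_def A_def)
  have "finite (f u)" if "u \<in> A" for u using A2[OF that] card.infinite by fastforce
  then have finU: "finite (\<Union>(f ` A))" using finAB by auto
  have "card (\<Union>(f ` A)) \<le> (\<Sum>u\<in>A. card (f u))" using finAB by (intro card_UN_le) auto
  also have "\<dots> = 2 * card A" using A2 by simp
  also have "\<dots> \<le> 2 * a" using a A_def by simp
  finally have "k - 2 * a \<le> k - card (\<Union>(f ` A))" by simp
  also have "\<dots> \<le> card X" unfolding X_def
    using diff_card_le_card_Diff[of "\<Union>(f ` A)" "{1..k}"] finU by simp
  finally have "(k - 2 * a) choose 2 \<le> card X choose 2" by (rule binomial_right_mono)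
  also have "\<dots> = card {Y. Y \<subseteq> X \<and> card Y = 2}" by (rule n_subsets[symmetric]) (simp add: X_def)
  finally have "card B < card {Y. Y \<subseteq> X \<and> card Y = 2}" using b B_def by simp
  then have "card (f ` B) < card {Y. Y \<subseteq> X \<and> card Y = 2}"
    using card_image_le[OF finAB(2), of f] by simp
  then have "\<not> {Y. Y \<subseteq> X \<and> card Y = 2} \<subseteq> f ` B"
    using card_mono[of "f ` B" "{Y. Y \<subseteq> X \<and> card Y = 2}"] finite_imageI[OF finAB(2), of f] by linarith
  then obtain Y where Y: "Y \<subseteq> X" "card Y = 2" "Y \<notin> f ` B" by blast
  have disj: "f u \<inter> Y = {}" if "u \<in> A" for u using Y(1) that by (auto simp: X_def)
  have ne: "f u \<noteq> Y" if "u \<in> B" for u using Y(3) that by auto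
  let ?g = "f(v := Y)"
  have new: "(adj E u v \<longrightarrow> ?g u \<inter> ?g v = {}) \<and> ((\<exists>x. adj E u x \<and> adj E v x) \<longrightarrow> ?g u \<noteq> ?g v)"
    if "u \<in> C" for u
    using disj[of u] ne[of u] that v unfolding A_def B_def by (auto dest: adj_sym)
  have sym: "(adj E u w \<longrightarrow> ?g u \<inter> ?g w = {}) \<and> ((\<exists>x. adj E u x \<and> adj E w x) \<longrightarrow> ?g u \<noteq> ?g w)"
    if "(adj E w u \<longrightarrow> ?g w \<inter> ?g u = {}) \<and> ((\<exists>x. adj E w x \<and> adj E u x) \<longrightarrow> ?g w \<noteq> ?g u)" for u w
    using that adj_sym by (metis Int_commute)
  have "partial_coloring k E (insert v C) ?g" unfolding partial_coloring_def
  proof (intro conjI ballI impI)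
    fix u assume "u \<in> insert v C"
    then show "?g u \<subseteq> {1..k}" "card (?g u) = 2"
      using Y partial_coloringD(1,2)[OF f, of u] by (auto simp: X_def split: if_splits)
  next
    fix u w assume uw: "u \<in> insert v C" "w \<in> insert v C" "u \<noteq> w"
    have "(adj E u w \<longrightarrow> ?g u \<inter> ?g w = {}) \<and> ((\<exists>x. adj E u x \<and> adj E w x) \<longrightarrow> ?g u \<noteq> ?g w)"
    proof -
      consider "w = v" "u \<in> C" | "u = v" "w \<in> C" | "u \<in> C" "w \<in> C" using uw by blast
      then show ?thesis
      proof cases
        case 1 then show ?thesis using new by blast
      next
        case 2 then show ?thesis using sym[OF new] by blast
      next
        case 3
        then have "?g u = f u" "?g w = f w" using v by auto
        then show ?thesis using 3 partial_coloringD(3,4)[OF f, of u w] uw by metis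
      qed
    qed
    then show "adj E u w \<Longrightarrow> ?g u \<inter> ?g w = {}" "\<exists>x. adj E u x \<and> adj E w x \<Longrightarrow> ?g u \<noteq> ?g w"
      by blast+
  qed
  then show ?thesis by blast
qed

lemma partial_coloring_empty: "partial_coloring k E {} f"
  by (simp add: partial_coloring_def)

text \<open>Labels of size two meet in at most two colors, so only distances 1 and 2 impose a
  condition; two equal-sized labels that meet in two colors coincide.\<close>

lemma partial_coloring_imp_tone_coloring:
  assumes "partial_coloring k E {..<n} f"
  shows "tone_coloring 2 k n E f"
  unfolding tone_coloring_def
proof (intro conjI allI impI)
  fix u v assume uv: "u < n" "v < n" "u \<noteq> v"
  have c2: "card (f u) = 2" "card (f v) = 2" using assms uv by (auto simp: partial_coloring_def)
  then have fin: "finite (f u)" "finite (f v)" using card.infinite by fastforce+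
  have le: "card (f u \<inter> f v) \<le> 2" using card_mono[of "f u" "f u \<inter> f v"] fin c2 by simp
  show "enat (card (f u \<inter> f v)) < gdist E u v"
  proof (cases "\<exists>k. (adj E ^^ k) u v")
    case True
    define l where "l = (LEAST k. (adj E ^^ k) u v)"
    have l: "(adj E ^^ l) u v" unfolding l_def using True by (rule LeastI_ex)
    have "card (f u \<inter> f v) < l"
    proof -
      consider "l = 0" | "l = 1" | "l = 2" | "l > 2" by linarith
      then show ?thesis
      proof cases
        case 1 then show ?thesis using l uv by simp
      next
        case 2 then have "adj E u v" using l relpowp_1[of "adj E"] by metis
        then show ?thesis using 2 uv partial_coloringD(3)[OF assms, of u v] by simp
      next
        case 3
        then obtain x where "adj E u x" "adj E v x" using l by (auto simp: numeral_2_eq_2 dest: adj_sym)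
        then have ne: "f u \<noteq> f v" using partial_coloringD(4)[OF assms, of u v x] uv by simp
        have "card (f u \<inter> f v) \<noteq> 2"
        proof
          assume c: "card (f u \<inter> f v) = 2"
          then have "f u \<inter> f v = f u" "f u \<inter> f v = f v"
            using c2 fin card_subset_eq[of "f u" "f u \<inter> f v"] card_subset_eq[of "f v" "f u \<inter> f v"] by auto
          then show False using ne by simp
        qed
        then show ?thesis using le 3 by simp
      next
        case 4 then show ?thesis using le by simp
      qed
    qed
    then show ?thesis using True by (simp add: gdist_def l_def)
  qed (simp add: gdist_def)
qed (use assms in \<open>auto simp: partial_coloring_def\<close>)

lemma tone_coloring_degree:
  assumes f: "tone_coloring 2 k n E f" and E: "E \<subseteq> all_edges n" and v: "v < n"
  shows "degree E v \<le> (k - 2) choose 2"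
proof -
  let ?N = "{u. adj E v u}"
  have N: "f u \<inter> f v = {}" if "u \<in> ?N" for u
  proof -
    have "u < n" "u \<noteq> v" using that adj_bound[OF E] by auto
    then have "enat (card (f v \<inter> f u)) < gdist E v u" using f v by (auto simp: tone_coloring_def)
    moreover have "gdist E v u \<le> 1"
    proof -
      have "(adj E ^^ 1) v u" using that by (simp only: relpowp_1) simp
      then have "(LEAST k. (adj E ^^ k) v u) \<le> 1" "\<exists>k. (adj E ^^ k) v u"
        by (rule Least_le, rule exI)
      then show ?thesis by (simp add: gdist_def one_enat_def del: One_nat_def)
    qed
    ultimately have "card (f v \<inter> f u) = 0"
      by (metis enat_ord_simps(2) less_one one_enat_def order_less_le_trans)
    moreover have "finite (f v)" using f v by (auto simp: tone_coloring_def intro: finite_subset)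
    ultimately show ?thesis by auto
  qed
  have inj: "inj_on f ?N"
  proof (rule inj_onI, rule ccontr)
    fix x y assume xy: "x \<in> ?N" "y \<in> ?N" "f x = f y" "x \<noteq> y"
    have b: "x < n" "y < n" using xy adj_bound[OF E] by auto
    have "(adj E ^^ 2) x y" using xy by (auto simp: numeral_2_eq_2 dest: adj_sym)
    then have "(LEAST k. (adj E ^^ k) x y) \<le> 2" "\<exists>k. (adj E ^^ k) x y"
      by (rule Least_le, rule exI)
    then have "gdist E x y \<le> enat 2" by (simp add: gdist_def)
    moreover have "enat (card (f x \<inter> f y)) < gdist E x y" using f b xy(4) unfolding tone_coloring_def by blast
    moreover have "card (f x \<inter> f y) = 2" using f b xy by (auto simp: tone_coloring_def)
    ultimately show False by simp
  qed
  have "f ` ?N \<subseteq> {Y. Y \<subseteq> {1..k} - f v \<and> card Y = 2}"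
  proof
    fix Y assume "Y \<in> f ` ?N"
    then obtain u where u: "adj E v u" "Y = f u" by auto
    then have "u < n" using adj_bound[OF E] by blast
    then show "Y \<in> {Y. Y \<subseteq> {1..k} - f v \<and> card Y = 2}"
      using f N[of u] u unfolding tone_coloring_def by auto
  qed
  then have "card (f ` ?N) \<le> card {Y. Y \<subseteq> {1..k} - f v \<and> card Y = 2}"
    by (intro card_mono) auto
  also have "\<dots> = card ({1..k} - f v) choose 2" by (intro n_subsets) simp
  also have "card ({1..k} - f v) = k - 2"
    using f v by (subst card_Diff_subset) (auto simp: tone_coloring_def intro: finite_subset)
  finally show ?thesis using card_image[OF inj] by (simp add: degree_conv_adj)
qed

section \<open>Coloring graphs that are locally trees around heavy vertices\<close>

lemma connected_in_path:
  shows "adj E a b \<Longrightarrow> connected_in E {a,b}"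
    and "adj E a b \<Longrightarrow> adj E b c \<Longrightarrow> connected_in E {a,b,c}"
    and "adj E a b \<Longrightarrow> adj E b c \<Longrightarrow> adj E c d \<Longrightarrow> connected_in E {a,b,c,d}"
    and "adj E a b \<Longrightarrow> adj E b c \<Longrightarrow> adj E c d \<Longrightarrow> adj E d e \<Longrightarrow> connected_in E {a,b,c,d,e}"
proof -
  show 2: "connected_in E {a,b}" if "adj E a b" for a b
    using connected_in_insert[OF connected_in_singleton[of E b], of b a] adj_sym[OF that] by simp
  show 3: "connected_in E {a,b,c}" if "adj E a b" "adj E b c" for a b c
    using connected_in_insert[OF 2[OF that(2)], of b a] adj_sym[OF that(1)] by simp
  show 4: "connected_in E {a,b,c,d}" if "adj E a b" "adj E b c" "adj E c d" for a b c d
    using connected_in_insert[OF 3[OF that(2,3)], of b a] adj_sym[OF that(1)] by simp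
  show "connected_in E {a,b,c,d,e}" if "adj E a b" "adj E b c" "adj E c d" "adj E d e"
    using connected_in_insert[OF 4[OF that(2,3,4)], of b a] adj_sym[OF that(1)] by simp
qed

lemma card_le_path:
  "card {a,b} \<le> 2" "card {a,b,c} \<le> 3" "card {a,b,c,d} \<le> 4" "card {a,b,c,d,e} \<le> 5"
  by (simp_all add: card_insert_if)

text \<open>The interface between the random graph and the coloring. \<open>R\<close> will bound the
  number of heavy vertices near any vertex, and \<open>d\<close> is the degeneracy. The size
  \<open>8 * (R + 1)\<close> is that of a union of \<open>R + 1\<close> sets of size 8, which
  \<open>card_near_heavy\<close> needs. The two numerical conditions at the end tie \<open>R\<close>
  and \<open>d\<close> to the threshold \<epsilon> for heavy vertices.\<close>

locale sparse_graph =
  fixes E :: "nat set set" and n R d :: nat and L \<epsilon> :: real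
  assumes edges: "E \<subseteq> all_edges n"
    and small_degree_sum: "\<And>T. T \<subseteq> {..<n} \<Longrightarrow> card T \<le> 8 * (R + 1) \<Longrightarrow>
      card T \<le> card (inner_edges E T) + 1 \<Longrightarrow> real (\<Sum>v\<in>T. degree E v) < 5/4 * L"
    and small_cycle: "\<And>T v. T \<subseteq> {..<n} \<Longrightarrow> card T \<le> 8 * (R + 1) \<Longrightarrow>
      card T \<le> card (inner_edges E T) \<Longrightarrow> v \<in> T \<Longrightarrow> real (degree E v) < \<epsilon> * L"
    and degenerate: "\<And>W. W \<subseteq> {..<n} \<Longrightarrow> W \<noteq> {} \<Longrightarrow> \<exists>v\<in>W. card {u\<in>W. adj E v u} \<le> d"
    and max_degree_ge: "5/6 * L \<le> real (max_degree n E)"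
    and L_pos: "L > 0" and eps_pos: "\<epsilon> > 0"
    and R_eps: "5/4 \<le> real (R + 1) * \<epsilon>"
    and d_eps: "real d * \<epsilon> \<le> 1/100"
begin

definition heavy :: "nat set" where
  "heavy = {v. v < n \<and> \<epsilon> * L \<le> real (degree E v)}"

text \<open>The bound 8 comes from \<open>card_core_near\<close>: a set of at most 3 vertices, a
  witness of at most 4 and one further heavy vertex are joined there.\<close>

definition near_heavy :: "nat \<Rightarrow> nat set" where
  "near_heavy v = {h\<in>heavy. \<exists>Q\<subseteq>{..<n}. connected_in E Q \<and> v \<in> Q \<and> h \<in> Q \<and> card Q \<le> 8}"

definition halo :: "nat set" where
  "halo = heavy \<union> {v. \<exists>u\<in>heavy. adj E v u}"

text \<open>The \<open>core\<close> collects the vertices of the \<open>halo\<close> that can conflict with another one in more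
  than one way: a vertex outside the core is within distance two of the rest of the halo only
  through its unique heavy neighbor.\<close>
definition core :: "nat set" where
  "core = heavy \<union> {v. \<exists>u\<in>heavy. adj E v u \<and>
     (\<exists>Q\<subseteq>{..<n}. connected_in E Q \<and> v \<in> Q \<and> u \<notin> Q \<and> Q \<inter> heavy \<noteq> {} \<and> card Q \<le> 4)}"

section \<open>Counting heavy and core vertices near a given vertex\<close>

lemma adj_less: "adj E u v \<Longrightarrow> u < n" "adj E u v \<Longrightarrow> v < n"
  using adj_bound[OF edges] by auto

lemma heavy_less: "h \<in> heavy \<Longrightarrow> h < n" by (simp add: heavy_def)

lemma core_subset: "heavy \<subseteq> core" "core \<subseteq> halo" "halo \<subseteq> {..<n}"
  by (auto simp: core_def halo_def heavy_less adj_less)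

lemma fin_less: "T \<subseteq> {..<n} \<Longrightarrow> finite T" by (rule finite_subset) auto

lemma finite_sets: "finite heavy" "finite core" "finite halo"
  using core_subset by (auto intro!: fin_less)

text \<open>The source of the uniqueness and injectivity arguments below: two different routes to
  the same heavy vertex would close a short cycle, and all vertices of such a small set have degree
  below \<epsilon> L.\<close>

lemma no_cycle_at_heavy:
  assumes "connected_in E T" "T \<subseteq> {..<n}" "card T \<le> 7" "v \<notin> T" "x \<in> T" "y \<in> T" "x \<noteq> y"
    "adj E v x" "adj E v y" "h \<in> heavy" "h \<in> insert v T"
  shows False
proof -
  have "card (insert v T) \<le> card (inner_edges E (insert v T))"
    using cycle_inner_edges assms fin_less by blast
  then have "real (degree E h) < \<epsilon> * L"
    using assms adj_less fin_less[OF assms(2)] by (intro small_cycle[of "insert v T"]) auto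
  then show False using assms(10) by (simp add: heavy_def)
qed

text \<open>The witnesses of \<open>R + 1\<close> heavy vertices share \<open>v\<close>, so their
  union is a small connected set. Its degree sum would be at least (R + 1) \<epsilon> L, which is at
  least 5/4 L by the choice of \<open>R\<close>.\<close>

lemma card_near_heavy: "finite (near_heavy v)" "card (near_heavy v) \<le> R"
proof -
  show fin: "finite (near_heavy v)"
    by (rule finite_subset[OF _ finite_sets(1)]) (auto simp: near_heavy_def)
  show "card (near_heavy v) \<le> R"
  proof (rule ccontr)
    assume "\<not> ?thesis"
    then have "R + 1 \<le> card (near_heavy v)" by simp
    then obtain X where X: "X \<subseteq> near_heavy v" "card X = R + 1" "finite X"
      using obtain_subset_with_card_n by metis
    have "\<forall>h\<in>X. \<exists>Q\<subseteq>{..<n}. connected_in E Q \<and> v \<in> Q \<and> h \<in> Q \<and> card Q \<le> 8"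
      using X(1) by (auto simp: near_heavy_def)
    then obtain Q where Q: "\<And>h. h \<in> X \<Longrightarrow> Q h \<subseteq> {..<n} \<and> connected_in E (Q h) \<and> v \<in> Q h \<and> h \<in> Q h \<and> card (Q h) \<le> 8"
      by metis
    define T where "T = \<Union>(Q ` X)"
    have T: "T \<subseteq> {..<n}" using Q by (auto simp: T_def)
    have conn: "connected_in E T" unfolding T_def using Q by (intro connected_in_Union[of _ _ v]) auto
    have "card T \<le> (\<Sum>h\<in>X. card (Q h))" unfolding T_def using X by (intro card_UN_le) auto
    also have "\<dots> \<le> (\<Sum>h\<in>X. 8)" using Q by (intro sum_mono) auto
    finally have cT: "card T \<le> 8 * (R + 1)" using X by simp
    have XT: "X \<subseteq> T" using Q by (auto simp: T_def)
    have "5/4 * L \<le> real (R + 1) * \<epsilon> * L" using R_eps L_pos by (intro mult_right_mono) auto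
    also have "\<dots> = (\<Sum>h\<in>X. \<epsilon> * L)" using X by simp
    also have "\<dots> \<le> (\<Sum>h\<in>X. real (degree E h))"
      using X(1) by (intro sum_mono) (auto simp: near_heavy_def heavy_def)
    also have "\<dots> \<le> (\<Sum>h\<in>T. real (degree E h))"
      using XT fin_less[OF T] by (intro sum_mono2) auto
    also have "\<dots> < 5/4 * L"
      using small_degree_sum[OF T cT connected_in_inner_edges[OF conn fin_less[OF T]]] by simp
    finally show False by simp
  qed
qed

lemma near_heavyI:
  assumes "h \<in> heavy" "Q \<subseteq> {..<n}" "connected_in E Q" "v \<in> Q" "h \<in> Q" "card Q \<le> 8"
  shows "h \<in> near_heavy v"
  using assms by (auto simp: near_heavy_def)

text \<open>A core vertex near \<open>v\<close> is either heavy itself, which leaves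
  \<open>R\<close> choices, or it is determined by its heavy neighbor and a heavy vertex of its
  witness. Both of these are near \<open>v\<close>, which leaves \<open>R * R\<close>
  choices.\<close>

lemma card_core_near:
  assumes "v < n"
  shows "card {x\<in>core. \<exists>P\<subseteq>{..<n}. connected_in E P \<and> v \<in> P \<and> x \<in> P \<and> card P \<le> 3} \<le> R + R * R"
    (is "card ?C \<le> _")
proof -
  have 1: "?C \<inter> heavy \<subseteq> near_heavy v"
  proof clarify
    fix x P assume "x \<in> heavy" "P \<subseteq> {..<n}" "connected_in E P" "v \<in> P" "x \<in> P" "card P \<le> 3"
    then show "x \<in> near_heavy v" by (intro near_heavyI[of x P]) auto
  qed
  define wit where "wit x u h Q \<longleftrightarrow> u \<in> heavy \<and> adj E x u \<and> Q \<subseteq> {..<n} \<and> connected_in E Q \<and>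
      x \<in> Q \<and> u \<notin> Q \<and> h \<in> Q \<and> h \<in> heavy \<and> card Q \<le> 4" for x u h Q
  define D where "D = ?C - heavy"
  have "\<exists>u h Q. wit x u h Q" if "x \<in> D" for x
  proof -
    have "x \<in> core" "x \<notin> heavy" using that unfolding D_def by blast+
    then show ?thesis unfolding core_def wit_def by blast
  qed
  then obtain u h Q where "\<And>x. x \<in> D \<Longrightarrow> wit x (u x) (h x) (Q x)" by metis
  note q = this[unfolded wit_def]
  (* Two vertices with the same pair of heavy vertices would close a cycle through u x. *)
  have "inj_on (\<lambda>x. (u x, h x)) D"
  proof (rule inj_onI, rule ccontr)
    fix x y assume xy: "x \<in> D" "y \<in> D" "(u x, h x) = (u y, h y)" "x \<noteq> y"
    note x = q[OF xy(1)] and y = q[OF xy(2)]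
    \<comment> \<open>The shared vertex \<open>h x\<close> brings 4 + 4 down to 7, the largest size
      that \<open>no_cycle_at_heavy\<close> admits.\<close>
    have c: "card (Q x \<union> Q y) \<le> 7"
    proof -
      have "h x \<in> Q x \<inter> Q y" using x y xy(3) by auto
      then have "card (Q x \<inter> Q y) > 0" using x fin_less by (auto simp: card_gt_0_iff)
      then show ?thesis using card_Un_Int[of "Q x" "Q y"] x y fin_less by auto
    qed
    show False
      using x y xy c by (intro no_cycle_at_heavy[of "Q x \<union> Q y" "u x" x y "u x"])
        (auto intro: connected_in_Un[of _ _ _ "h x"] adj_sym)
  qed
  moreover have "(\<lambda>x. (u x, h x)) ` D \<subseteq> near_heavy v \<times> near_heavy v"
  proof clarify
    fix x assume xD: "x \<in> D"
    then obtain P where P: "P \<subseteq> {..<n}" "connected_in E P" "v \<in> P" "x \<in> P" "card P \<le> 3"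
      unfolding D_def by blast
    note x = q[OF xD]
    let ?Q = "insert (u x) (P \<union> Q x)"
    have "connected_in E (P \<union> Q x)" using x P by (auto intro: connected_in_Un[of _ _ _ x])
    then have c: "connected_in E ?Q" using x P by (auto intro: connected_in_insert)
    have "card (P \<union> Q x) \<le> 7" using card_Un_le[of P "Q x"] x P by linarith
    then have "card ?Q \<le> 8" using card_insert_le_m1[of 8 "P \<union> Q x" "u x"] by simp
    then show "u x \<in> near_heavy v \<and> h x \<in> near_heavy v"
      using x P c by (auto intro!: near_heavyI[of _ ?Q] simp: heavy_less)
  qed
  ultimately have "card D \<le> card (near_heavy v \<times> near_heavy v)"
    using card_near_heavy(1) by (intro card_inj_on_le) auto
  also have "\<dots> \<le> R * R" using card_near_heavy(2) by (simp add: card_cartesian_product mult_mono)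
  finally have 2: "card D \<le> R * R" .
  have "?C = (?C \<inter> heavy) \<union> D" unfolding D_def by blast
  then have "card ?C \<le> card (?C \<inter> heavy) + card D"
    using card_Un_le[of "?C \<inter> heavy" "D"] by simp
  moreover have "card (?C \<inter> heavy) \<le> R"
    using card_mono[OF card_near_heavy(1) 1] card_near_heavy(2)[of v] by linarith
  ultimately show ?thesis using 2 by linarith
qed

section \<open>The three coloring phases\<close>

lemma color_core:
  assumes k: "R + R * R < (k - 2 * (R + R * R)) choose 2"
  shows "\<exists>f. partial_coloring k E core f"
proof -
  have "\<exists>f. partial_coloring k E C f" if "finite C" "C \<subseteq> core" for C
    using that
  proof (induction C rule: finite_induct)
    case empty then show ?case using partial_coloring_empty by blast
  next
    case (insert v C)
    then obtain f where f: "partial_coloring k E C f" by auto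
    have v: "v < n" using insert core_subset by auto
    \<comment> \<open>Every conflict of \<open>v\<close> inside the core comes from a path with at
      most three vertices. So the number of conflicts is bounded by a constant, and the core can be
      colored in any order once \<open>k\<close> is large.\<close>
    let ?C = "{x\<in>core. \<exists>P\<subseteq>{..<n}. connected_in E P \<and> v \<in> P \<and> x \<in> P \<and> card P \<le> 3}"
    have fin: "finite ?C" using finite_sets by auto
    have "{u \<in> C. adj E v u} \<subseteq> ?C"
    proof clarify
      fix u assume "u \<in> C" "adj E v u"
      then show "u \<in> core \<and> (\<exists>P\<subseteq>{..<n}. connected_in E P \<and> v \<in> P \<and> u \<in> P \<and> card P \<le> 3)"
        using insert adj_less connected_in_path(1)[of E v u] card_le_path(1)[of v u]
        by (intro conjI exI[of _ "{v,u}"]) auto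
    qed
    then have 1: "card {u \<in> C. adj E v u} \<le> R + R * R"
      using card_mono[OF fin] card_core_near[OF v] by (meson le_trans)
    have "{u \<in> C. \<exists>x. adj E v x \<and> adj E u x} \<subseteq> ?C"
    proof clarify
      fix u x assume "u \<in> C" "adj E v x" "adj E u x"
      then show "u \<in> core \<and> (\<exists>P\<subseteq>{..<n}. connected_in E P \<and> v \<in> P \<and> u \<in> P \<and> card P \<le> 3)"
        using insert adj_less connected_in_path(2)[of E v x u] card_le_path(2)[of v x u] adj_sym
        by (intro conjI exI[of _ "{v,x,u}"]) auto
    qed
    then have 2: "card {u \<in> C. \<exists>x. adj E v x \<and> adj E u x} < (k - 2 * (R + R * R)) choose 2"
      using card_mono[OF fin] card_core_near[OF v] k by (meson le_less_trans)
    show ?case using partial_coloring_extend[OF f _ _ 1 2] insert by blast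
  qed
  then show ?thesis using finite_sets by blast
qed

text \<open>Any other connection from \<open>v\<close> to the halo leads within four vertices to a
  heavy vertex. If it avoids \<open>u\<close>, it is a witness that puts \<open>v\<close> into the
  core; if it ends in \<open>u\<close>, it closes a short cycle through \<open>u\<close>.\<close>

lemma leaf_neighbors:
  assumes v: "v \<in> halo - core" and u: "u \<in> heavy" "adj E v u"
  shows "w \<in> halo \<Longrightarrow> adj E v w \<Longrightarrow> w = u"
    and "w \<in> halo \<Longrightarrow> w \<noteq> v \<Longrightarrow> adj E v x \<Longrightarrow> adj E w x \<Longrightarrow> x = u"
proof -
  have vh: "v \<notin> heavy" "v \<noteq> u" using v u core_subset by auto
  have no: False if "Q\<subseteq>{..<n}" "connected_in E Q" "v \<in> Q" "u \<notin> Q" "h \<in> Q" "h \<in> heavy" "card Q \<le> 4" for Q h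
    using that u v by (auto simp: core_def)
  show 1: "w = u" if w: "w \<in> halo" "adj E v w" for w
  proof (rule ccontr)
    assume wu: "w \<noteq> u"
    have vw: "v \<noteq> w" using w by auto
    have "w \<notin> heavy"
      using no[of "{v,w}" w] w wu vh connected_in_path(1)[of E v w] adj_less card_le_path(1)[of v w] by auto
    then obtain h where h: "h \<in> heavy" "adj E w h" using w by (auto simp: halo_def)
    show False
    proof (cases "h = u")
      case True
      then show False
        using no_cycle_at_heavy[of "{w,u}" v w u u] h w wu vh u vw connected_in_path(1)[of E w u]
          adj_less card_le_path(1)[of w u] by auto
    next
      case False
      then show False
        using no[of "{v,w,h}" h] h w wu vh connected_in_path(2)[of E v w h] adj_less card_le_path(2)[of v w h] by auto
    qed
  qed
  show "x = u" if w: "w \<in> halo" "w \<noteq> v" "adj E v x" "adj E w x"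
  proof (rule ccontr)
    assume xu: "x \<noteq> u"
    \<comment> \<open>By the first claim \<open>u\<close> is the only halo neighbor of
      \<open>v\<close>. As \<open>x\<close> is adjacent to \<open>w\<close> but outside the halo,
      \<open>w\<close> cannot be heavy and owes its place in the halo to a heavy neighbor
      \<open>h\<close>.\<close>
    have "x \<notin> halo" using 1 w xu by blast
    then have wh: "w \<notin> heavy" using w adj_sym by (auto simp: halo_def)
    have neq: "x \<noteq> v" "x \<noteq> w" using w by auto
    obtain h where h: "h \<in> heavy" "adj E w h" using wh w by (auto simp: halo_def)
    have wu: "w \<noteq> u" using wh u by auto
    have ls: "v < n" "x < n" "w < n" "h < n" "u < n" using w h u adj_less by auto
    show False
    proof (cases "h = u")
      case True
      have "connected_in E {x,w,u}" using connected_in_path(2)[of E x w u] w h True adj_sym by auto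
      then show False
        using no_cycle_at_heavy[of "{x,w,u}" v x u u] card_le_path(2)[of x w u] w vh neq u ls xu by auto
    next
      case False
      have "connected_in E {v,x,w,h}" using connected_in_path(3)[of E v x w h] w h adj_sym by auto
      then show False
        using no[of "{v,x,w,h}" h] card_le_path(3)[of v x w h] h False wu xu vh ls by auto
    qed
  qed
qed

lemma color_halo:
  assumes k: "R + R * R < (k - 2 * (R + R * R)) choose 2" and D: "max_degree n E \<le> (k - 2) choose 2"
  shows "\<exists>f. partial_coloring k E halo f"
proof -
  have "\<exists>f. partial_coloring k E (core \<union> C) f" if "finite C" "C \<subseteq> halo - core" for C
    using that
  proof (induction C rule: finite_induct)
    case empty then show ?case using color_core[OF k] by simp
  next
    case (insert v C)
    then obtain f where f: "partial_coloring k E (core \<union> C) f" by auto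
    have v: "v \<in> halo - core" using insert by auto
    then obtain u where u: "u \<in> heavy" "adj E v u" using core_subset by (auto simp: halo_def)
    have sub: "core \<union> C \<subseteq> halo" using insert core_subset by auto
    have fin: "finite (core \<union> C)" using sub finite_sets finite_subset by blast
    have "{w \<in> core \<union> C. adj E v w} \<subseteq> {u}" using leaf_neighbors(1)[OF v u] sub by auto
    then have 1: "card {w \<in> core \<union> C. adj E v w} \<le> 1" using card_mono[of "{u}"] by fastforce
    \<comment> \<open>All conflicts at distance two run through \<open>u\<close>. The vertex
      \<open>v\<close> is itself an uncolored neighbor of \<open>u\<close>, and this saves the one
      label that makes the bound strict even if the maximum degree equals
      \<open>(k - 2) choose 2\<close>.\<close>
    have "v \<notin> core \<union> C" using v insert by auto
    then have "{w \<in> core \<union> C. \<exists>x. adj E v x \<and> adj E w x} \<subseteq> {w. adj E u w} - {v}"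
      using leaf_neighbors(2)[OF v u] sub adj_sym by blast
    then have "card {w \<in> core \<union> C. \<exists>x. adj E v x \<and> adj E w x} \<le> card ({w. adj E u w} - {v})"
      using finite_nbrs[OF edges] by (intro card_mono) auto
    also have "\<dots> < card {w. adj E u w}"
      using finite_nbrs[OF edges] adj_sym[OF u(2)] by (intro psubset_card_mono) auto
    also have "\<dots> \<le> max_degree n E"
      using degree_le_max_degree[OF edges heavy_less[OF u(1)]] by (simp add: degree_conv_adj)
    also have "\<dots> \<le> (k - 2 * 1) choose 2" using D by simp
    finally have 2: "card {w \<in> core \<union> C. \<exists>x. adj E v x \<and> adj E w x} < (k - 2 * 1) choose 2" .
    show ?case using partial_coloring_extend[OF f \<open>v \<notin> core \<union> C\<close> fin 1 2] by simp
  qed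
  from this[of "halo - core"] have "\<exists>f. partial_coloring k E (core \<union> (halo - core)) f"
    using finite_sets by auto
  moreover have "core \<union> (halo - core) = halo" using core_subset by auto
  ultimately show ?thesis by simp
qed

text \<open>A halo neighbor \<open>w\<close> of a vertex \<open>v\<close> outside the halo is not
  heavy, so it has a heavy neighbor \<open>u w\<close>. Two of them with the same \<open>u w\<close>
  would form a 4-cycle with \<open>v\<close>, hence the \<open>u w\<close> are distinct heavy
  vertices near \<open>v\<close>. The paths v, w, \<open>u w\<close> together form a small connected
  set to which the degree sum bound applies.\<close>

lemma outside_halo:
  assumes v: "v \<notin> halo"
  shows "card {w\<in>halo. adj E v w} \<le> R"
    and "real (\<Sum>w\<in>{w\<in>halo. adj E v w}. degree E w) \<le> 5/8 * L"
proof -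
  define W where "W = {w\<in>halo. adj E v w}"
  have finW: "finite W" unfolding W_def using finite_sets by auto
  have light: "w \<notin> heavy" if "w \<in> W" for w using that v by (auto simp: W_def halo_def)
  have "\<exists>u. u \<in> heavy \<and> adj E w u" if "w \<in> W" for w
  proof -
    have "w \<in> halo" using that by (simp add: W_def)
    then show ?thesis using light[OF that] unfolding halo_def by blast
  qed
  then obtain u where u: "\<And>w. w \<in> W \<Longrightarrow> u w \<in> heavy" "\<And>w. w \<in> W \<Longrightarrow> adj E w (u w)" by metis
  have vw: "adj E v w" "v < n" "w < n" "v \<noteq> w" if "w \<in> W" for w
    using that adj_less by (auto simp: W_def)
  have vu: "v \<noteq> u w" if "w \<in> W" for w using u(1)[OF that] v by (auto simp: halo_def)
  have inj: "inj_on u W"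
  proof (rule inj_onI, rule ccontr)
    fix x y assume xy: "x \<in> W" "y \<in> W" "u x = u y" "x \<noteq> y"
    have "connected_in E {x,u x,y}"
      using connected_in_path(2)[of E x "u x" y] u(2)[OF xy(1)] u(2)[OF xy(2)] xy(3) by (simp add: adj_sym)
    then show False
      using vw[OF xy(1)] vw[OF xy(2)] vu[OF xy(1)] u(1)[OF xy(1)] xy heavy_less card_le_path(2)[of x "u x" y]
      by (intro no_cycle_at_heavy[of "{x,u x,y}" v x y "u x"]) auto
  qed
  have path: "connected_in E {v,w,u w}" if "w \<in> W" for w
    using connected_in_path(2)[of E v w "u w"] vw[OF that] u[OF that] by simp
  have "u ` W \<subseteq> near_heavy v"
  proof clarify
    fix w assume w: "w \<in> W"
    show "u w \<in> near_heavy v"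
      using path[OF w] u(1)[OF w] vw[OF w] heavy_less card_le_path(2)[of v w "u w"]
      by (intro near_heavyI[of _ "{v,w,u w}"]) auto
  qed
  then have cW: "card W \<le> R"
    using card_inj_on_le[OF inj _ card_near_heavy(1)] card_near_heavy(2)[of v] by fastforce
  then show "card {w\<in>halo. adj E v w} \<le> R" by (simp add: W_def)
  have "real (\<Sum>w\<in>W. degree E w) \<le> 5/8 * L"
  proof (cases "W = {}")
    case True
    then show ?thesis using L_pos by simp
  next
    case False
    define T where "T = insert v (W \<union> u ` W)"
    have Teq: "T = (\<Union>w\<in>W. {v,w,u w})" using False by (auto simp: T_def)
    have conn: "connected_in E T" unfolding Teq using path by (intro connected_in_Union[of _ _ v]) auto
    have T: "T \<subseteq> {..<n}" unfolding Teq using vw u heavy_less by auto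
    have "card T \<le> Suc (card W + card (u ` W))"
      using card_insert_le_m1[of "Suc (card W + card (u ` W))" "W \<union> u ` W" v] card_Un_le[of W "u ` W"]
      by (simp add: T_def)
    also have "\<dots> \<le> 8 * (R + 1)" using cW card_image_le[OF finW, of u] by simp
    finally have cT: "card T \<le> 8 * (R + 1)" .
    (* The heavy vertices u w have larger degrees than the w, so the w take at most half of the sum. *)
    have dis: "W \<inter> u ` W = {}" using light u by auto
    have "(\<Sum>w\<in>W. degree E w) + (\<Sum>w\<in>W. degree E (u w)) = (\<Sum>w\<in>W \<union> u ` W. degree E w)"
      using dis finW inj by (simp add: sum.union_disjoint sum.reindex)
    also have "\<dots> \<le> (\<Sum>w\<in>T. degree E w)"
      using fin_less[OF T] by (intro sum_mono2) (auto simp: T_def)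
    finally have "real (\<Sum>w\<in>W. degree E w) + real (\<Sum>w\<in>W. degree E (u w)) < 5/4 * L"
      using small_degree_sum[OF T cT connected_in_inner_edges[OF conn fin_less[OF T]]]
      by (metis of_nat_add of_nat_mono order_le_less_trans)
    moreover have "(\<Sum>w\<in>W. real (degree E w)) \<le> (\<Sum>w\<in>W. real (degree E (u w)))"
    proof (rule sum_mono)
      fix w assume w: "w \<in> W"
      have "real (degree E w) < \<epsilon> * L" using light[OF w] vw[OF w] by (auto simp: heavy_def)
      moreover have "\<epsilon> * L \<le> real (degree E (u w))" using u[OF w] by (auto simp: heavy_def)
      ultimately show "real (degree E w) \<le> real (degree E (u w))" by simp
    qed
    ultimately show ?thesis by simp
  qed
  then show "real (\<Sum>w\<in>{w\<in>halo. adj E v w}. degree E w) \<le> 5/8 * L" unfolding W_def .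
qed

text \<open>The same injection into \<open>near_heavy v\<close>, one step further out. It bounds the
  conflicts with halo vertices whose common neighbor with \<open>v\<close> lies outside the halo. A
  repeated value of \<open>u\<close> yields a 4-cycle if the middle vertices agree and a 6-cycle
  through \<open>v\<close> if they differ.\<close>

lemma outside_halo_second:
  assumes v: "v \<notin> halo"
  shows "card {w\<in>halo. \<exists>x. x \<notin> halo \<and> adj E v x \<and> adj E w x} \<le> R"
proof -
  define W where "W = {w\<in>halo. \<exists>x. x \<notin> halo \<and> adj E v x \<and> adj E w x}"
  have "\<exists>x. x \<notin> halo \<and> adj E v x \<and> adj E w x" if "w \<in> W" for w using that by (auto simp: W_def)
  then obtain x where x: "\<And>w. w \<in> W \<Longrightarrow> x w \<notin> halo" "\<And>w. w \<in> W \<Longrightarrow> adj E v (x w)" "\<And>w. w \<in> W \<Longrightarrow> adj E w (x w)"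
    by metis
  have light: "w \<notin> heavy" if "w \<in> W" for w
    using x(1,3)[OF that] by (auto simp: halo_def dest: adj_sym)
  have "\<exists>u. u \<in> heavy \<and> adj E w u" if "w \<in> W" for w
  proof -
    have "w \<in> halo" using that by (simp add: W_def)
    then show ?thesis using light[OF that] unfolding halo_def by blast
  qed
  then obtain u where u: "\<And>w. w \<in> W \<Longrightarrow> u w \<in> heavy" "\<And>w. w \<in> W \<Longrightarrow> adj E w (u w)" by metis
  have uh: "u w \<in> halo" if "w \<in> W" for w using u(1)[OF that] by (auto simp: halo_def)
  have wh: "w \<in> halo" if "w \<in> W" for w using that by (auto simp: W_def)
  have ls: "v < n" "w < n" "x w < n" "u w < n" if "w \<in> W" for w
    using x(2,3)[OF that] u(1)[OF that] adj_less heavy_less by auto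
  have inj: "inj_on u W"
  proof (rule inj_onI, rule ccontr)
    fix a b assume ab: "a \<in> W" "b \<in> W" "u a = u b" "a \<noteq> b"
    note a = x(1)[OF ab(1)] x(2)[OF ab(1)] x(3)[OF ab(1)] u(1)[OF ab(1)] u(2)[OF ab(1)] ls[OF ab(1)]
      uh[OF ab(1)] wh[OF ab(1)]
    note b = x(1)[OF ab(2)] x(2)[OF ab(2)] x(3)[OF ab(2)] u(1)[OF ab(2)] u(2)[OF ab(2)] ls[OF ab(2)] wh[OF ab(2)]
    have nv: "v \<noteq> a" "v \<noteq> b" "v \<noteq> u a" using a b v by auto
    show False
    proof (cases "x a = x b")
      case True
      have "connected_in E {a,u a,b}"
        using connected_in_path(2)[of E a "u a" b] a b ab by (simp add: adj_sym)
      moreover have "adj E (x a) a" "adj E (x a) b" using a b True by (auto dest: adj_sym)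
      moreover have "x a \<noteq> a" "x a \<noteq> b" "x a \<noteq> u a" using a b by auto
      ultimately show False
        using a b ab card_le_path(2)[of a "u a" b]
        by (intro no_cycle_at_heavy[of "{a,u a,b}" "x a" a b "u a"]) auto
    next
      case False
      have "connected_in E {x a,a,u a,b,x b}"
        using connected_in_path(4)[of E "x a" a "u a" b "x b"] a b ab by (simp add: adj_sym)
      moreover have "v \<noteq> x a" "v \<noteq> x b" using a b by auto
      ultimately show False
        using a b ab nv False card_le_path(4)[of "x a" a "u a" b "x b"]
        by (intro no_cycle_at_heavy[of "{x a,a,u a,b,x b}" v "x a" "x b" "u a"]) auto
    qed
  qed
  have "u ` W \<subseteq> near_heavy v"
  proof clarify
    fix w assume w: "w \<in> W"
    have "connected_in E {v,x w,w,u w}"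
      using connected_in_path(3)[of E v "x w" w "u w"] x(2,3)[OF w] u(2)[OF w] by (simp add: adj_sym)
    then show "u w \<in> near_heavy v"
      using u(1)[OF w] ls[OF w] card_le_path(3)[of v "x w" w "u w"]
      by (intro near_heavyI[of _ "{v,x w,w,u w}"]) auto
  qed
  then have "card W \<le> R" using card_inj_on_le[OF inj _ card_near_heavy(1)] card_near_heavy(2)[of v] by fastforce
  then show ?thesis by (simp add: W_def)
qed

lemma color_all:
  assumes k: "R + R * R < (k - 2 * (R + R * R)) choose 2" and D: "max_degree n E \<le> (k - 2) choose 2"
    and k': "13/20 * L + real R < real ((k - 2 * (R + d)) choose 2)"
  shows "\<exists>f. partial_coloring k E {..<n} f"
proof -
  (* Removing a vertex with few neighbors in W keeps the invariant that every uncolored vertex has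
     at most d neighbors in W; it bounds the conflicts through uncolored common neighbors. *)
  have "\<exists>f. partial_coloring k E (halo \<union> W) f"
    if "card W = m" "W \<subseteq> {..<n} - halo" "\<forall>x\<in>{..<n} - halo - W. card {w\<in>W. adj E x w} \<le> d" for m W
    using that
  proof (induction m arbitrary: W)
    case 0
    then have "W = {}" using fin_less[of W] by (metis Diff_subset card_0_eq subset_trans)
    then show ?case using color_halo[OF k D] by simp
  next
    case (Suc m)
    have finW: "finite W" using Suc.prems fin_less by blast
    have "W \<noteq> {}" using Suc.prems by auto
    then obtain v where v: "v \<in> W" "card {u\<in>W. adj E v u} \<le> d"
      using degenerate[of W] Suc.prems by blast
    define W' where "W' = W - {v}"
    have mono: "card {w\<in>W'. adj E x w} \<le> card {w\<in>W. adj E x w}" for x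
      using finW by (intro card_mono) (auto simp: W'_def)
    have out: "card {w\<in>W'. adj E x w} \<le> d" if "x \<in> {..<n} - halo - W'" for x
    proof (cases "x = v")
      case True then show ?thesis using v mono[of v] by simp
    next
      case False
      then have "x \<in> {..<n} - halo - W" using that by (auto simp: W'_def)
      then show ?thesis using Suc.prems(3) mono[of x] by (meson le_trans)
    qed
    have "card W' = m" using Suc.prems v finW by (simp add: W'_def)
    then obtain f where f: "partial_coloring k E (halo \<union> W') f"
      using Suc.IH[of W'] Suc.prems(2) out by (auto simp: W'_def)
    have vn: "v < n" "v \<notin> halo" using v Suc.prems by auto
    have finC: "finite (halo \<union> W')" using finW finite_sets by (auto simp: W'_def)
    have vC: "v \<notin> halo \<union> W'" using vn by (auto simp: W'_def)
    define A1 where "A1 = {w\<in>halo. adj E v w}"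
    define A2 where "A2 = {w\<in>W'. adj E v w}"
    define X where "X = {x. adj E v x \<and> x \<notin> halo \<and> x \<notin> W'}"
    have fin: "finite A1" "finite A2" "finite X"
      using finite_sets finW finite_nbrs[OF edges, of v] by (auto simp: A1_def A2_def X_def W'_def)
    have A1: "card A1 \<le> R" "real (\<Sum>w\<in>A1. degree E w) \<le> 5/8 * L"
      using outside_halo[OF vn(2)] by (auto simp: A1_def)
    have A2: "card A2 \<le> d" using out[of v] vn by (auto simp: A2_def W'_def)
    have light: "real (degree E w) \<le> \<epsilon> * L" if "w \<in> insert v A2" for w
    proof -
      have "w \<notin> halo" "w < n" using that vn Suc.prems(2) by (auto simp: A2_def W'_def)
      then show ?thesis by (auto simp: halo_def heavy_def)
    qed
    have "{w\<in>halo \<union> W'. adj E v w} = A1 \<union> A2" by (auto simp: A1_def A2_def)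
    then have 1: "card {w\<in>halo \<union> W'. adj E v w} \<le> R + d"
      using card_Un_le[of A1 A2] A1 A2 by simp
    let ?N = "\<lambda>w. {u. adj E w u}"
    let ?B = "{w\<in>halo \<union> W'. \<exists>x. adj E v x \<and> adj E w x}"
    let ?B1 = "\<Union>w\<in>A1. ?N w" and ?B2 = "\<Union>w\<in>A2. ?N w" and ?B3 = "\<Union>x\<in>X. {w\<in>W'. adj E x w}"
      and ?B4 = "{w\<in>halo. \<exists>x. x \<notin> halo \<and> adj E v x \<and> adj E w x}"
    have finN: "finite (?N w)" for w using finite_nbrs[OF edges] .
    have finW': "finite W'" using finW by (simp add: W'_def)
    \<comment> \<open>The cases follow the common neighbor \<open>x\<close>. It lies in the halo
      (\<open>?B1\<close>), in \<open>W'\<close> (\<open>?B2\<close>), or in neither; in the last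
      case the conflicting vertex is in \<open>W'\<close> and is counted by the invariant
      (\<open>?B3\<close>), or it is in the halo (\<open>?B4\<close>).\<close>
    have "?B \<subseteq> (?B1 \<union> ?B2) \<union> (?B3 \<union> ?B4)"
    proof
      fix w assume "w \<in> ?B"
      then obtain x where w: "w \<in> halo \<union> W'" "adj E v x" "adj E w x" by blast
      have w': "adj E x w" using w(3) by (rule adj_sym)
      show "w \<in> (?B1 \<union> ?B2) \<union> (?B3 \<union> ?B4)"
        using w w' unfolding A1_def A2_def X_def by blast
    qed
    then have "card ?B \<le> card ((?B1 \<union> ?B2) \<union> (?B3 \<union> ?B4))"
      using fin finN finW' finite_sets by (intro card_mono) auto
    also have "\<dots> \<le> (card ?B1 + card ?B2) + (card ?B3 + card ?B4)"
      by (intro order.trans[OF card_Un_le] add_mono card_Un_le)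
    finally have "real (card ?B) \<le> real (card ?B1) + real (card ?B2) + real (card ?B3) + real (card ?B4)"
      by linarith
    moreover have "real (card ?B1) \<le> 5/8 * L"
    proof -
      have "card ?B1 \<le> (\<Sum>w\<in>A1. degree E w)"
        unfolding degree_conv_adj by (rule card_UN_le[OF fin(1)])
      then show ?thesis using A1(2) by linarith
    qed
    moreover have "real (card ?B2) \<le> real d * \<epsilon> * L"
    proof -
      have "real (card ?B2) \<le> real (\<Sum>w\<in>A2. degree E w)"
        unfolding degree_conv_adj by (intro of_nat_mono card_UN_le[OF fin(2)])
      also have "\<dots> \<le> (\<Sum>w\<in>A2. \<epsilon> * L)" unfolding of_nat_sum using light by (intro sum_mono) auto
      also have "\<dots> \<le> real d * (\<epsilon> * L)" using A2 eps_pos L_pos by (simp add: mult_right_mono)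
      finally show ?thesis by (simp add: algebra_simps)
    qed
    moreover have "real (card ?B3) \<le> real d * \<epsilon> * L"
    proof -
      have X: "x \<in> {..<n} - halo - W'" if "x \<in> X" for x using that adj_less by (auto simp: X_def)
      have "card ?B3 \<le> (\<Sum>x\<in>X. card {w\<in>W'. adj E x w})" using fin by (intro card_UN_le) auto
      also have "\<dots> \<le> (\<Sum>x\<in>X. d)" by (intro sum_mono out X)
      also have "\<dots> \<le> degree E v * d"
        using card_mono[OF finN, of X v] by (auto simp: X_def degree_conv_adj)
      finally have "real (card ?B3) \<le> real (degree E v) * real d" by (metis of_nat_mono of_nat_mult)
      also have "\<dots> \<le> (\<epsilon> * L) * real d" using light[of v] by (intro mult_right_mono) auto
      finally show ?thesis by (simp add: algebra_simps)
    qed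
    moreover have "real (card ?B4) \<le> real R" using outside_halo_second[OF vn(2)] by simp
    moreover have "real d * \<epsilon> * L \<le> 1/100 * L" using d_eps L_pos by (intro mult_right_mono) auto
    \<comment> \<open>5/8 + 1/100 + 1/100 is less than 13/20, and \<open>?B4\<close> contributes the
      summand \<open>R\<close>.\<close>
    ultimately have "real (card ?B) < real ((k - 2 * (R + d)) choose 2)" using k' L_pos by linarith
    then have 2: "card ?B < (k - 2 * (R + d)) choose 2" by simp
    have "insert v (halo \<union> W') = halo \<union> W" using v by (auto simp: W'_def)
    then show ?case using partial_coloring_extend[OF f vC finC 1 2] by simp
  qed
  from this[of "{..<n} - halo"] have "\<exists>f. partial_coloring k E (halo \<union> ({..<n} - halo)) f" by auto
  moreover have "halo \<union> ({..<n} - halo) = {..<n}" using core_subset by auto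
  ultimately show ?thesis by simp
qed

end

section \<open>The 2-tone chromatic number of such graphs\<close>

lemma real_choose_two: "real (m choose 2) = real m * (real m - 1) / 2"
proof (induction m)
  case (Suc m)
  then show ?case by (simp add: numeral_2_eq_2 field_simps)
qed simp

lemma Least_int: "(LEAST k. c \<le> int k) = nat c"
  by (rule Least_equality) (simp, linarith)

text \<open>Completing the square: 8 * ((k - 2) choose 2) + 1 is the square of 2 k - 5, which is
  positive for k \<ge> 4.\<close>

lemma le_choose_two_iff:
  assumes "D \<ge> 1"
  shows "D \<le> (k - 2) choose 2 \<longleftrightarrow> \<lceil>(sqrt (8 * real D + 1) + 5) / 2\<rceil> \<le> int k"
proof (cases "k \<ge> 4")
  case True
  have "D \<le> (k - 2) choose 2 \<longleftrightarrow> real D \<le> real ((k - 2) choose 2)" by simp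
  also have "\<dots> \<longleftrightarrow> 8 * real D + 1 \<le> (2 * real k - 5)\<^sup>2"
  proof -
    have "(2 * real k - 5)\<^sup>2 = 8 * real ((k - 2) choose 2) + 1"
      using True by (simp add: real_choose_two of_nat_diff field_simps power2_eq_square)
    then show ?thesis by linarith
  qed
  also have "\<dots> \<longleftrightarrow> sqrt (8 * real D + 1) \<le> 2 * real k - 5"
  proof -
    have "sqrt ((2 * real k - 5)\<^sup>2) = 2 * real k - 5" using True by simp
    then show ?thesis using real_sqrt_le_iff[of "8 * real D + 1" "(2 * real k - 5)\<^sup>2"] by simp
  qed
  also have "\<dots> \<longleftrightarrow> (sqrt (8 * real D + 1) + 5) / 2 \<le> of_int (int k)" by (auto simp: field_simps)
  finally show ?thesis by (simp only: ceiling_le_iff)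
next
  case False
  then have "(k - 2) choose 2 = 0" by (intro binomial_eq_0) auto
  \<comment> \<open>For D \<ge> 1 the root is at least 3, so the ceiling is at least 4 and both
    sides fail for smaller \<open>k\<close>.\<close>
  moreover have "\<not> \<lceil>(sqrt (8 * real D + 1) + 5) / 2\<rceil> \<le> int k"
  proof -
    have "sqrt (3\<^sup>2) \<le> sqrt (8 * real D + 1)" using assms by (intro real_sqrt_le_mono) simp
    then have "real k < (sqrt (8 * real D + 1) + 5) / 2" using False by simp
    then show ?thesis by (simp add: ceiling_le_iff)
  qed
  moreover have "\<not> D \<le> (k - 2) choose 2" using assms calculation(1) by linarith
  ultimately show ?thesis by blast
qed

text \<open>Both right-hand sides are quadratic in \<open>k\<close> with leading coefficient 1/2.
  The factor 39/50 < 1 leaves a quadratic surplus that absorbs the shift by \<open>2 * g\<close> and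
  the constant \<open>R\<close>.\<close>

lemma many_labels:
  "\<exists>k0. \<forall>k\<ge>k0. M < (k - 2 * M) choose 2 \<and>
    39/50 * real ((k - 2) choose 2) + real R < real ((k - 2 * g) choose 2)"
proof -
  have "eventually (\<lambda>k::nat. real M < (real k - 2 * real M) * (real k - 2 * real M - 1) / 2) at_top"
    by real_asymp
  moreover have "eventually (\<lambda>k::nat. 39/50 * ((real k - 2) * (real k - 2 - 1) / 2) + real R <
      (real k - 2 * real g) * (real k - 2 * real g - 1) / 2) at_top"
    by real_asymp
  ultimately have "eventually (\<lambda>k::nat. real M < (real k - 2 * real M) * (real k - 2 * real M - 1) / 2 \<and>
      39/50 * ((real k - 2) * (real k - 2 - 1) / 2) + real R <
      (real k - 2 * real g) * (real k - 2 * real g - 1) / 2) at_top"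
    by (rule eventually_conj)
  then obtain k1 where k1: "\<And>k. k1 \<le> k \<Longrightarrow> real M < (real k - 2 * real M) * (real k - 2 * real M - 1) / 2"
      "\<And>k. k1 \<le> k \<Longrightarrow> 39/50 * ((real k - 2) * (real k - 2 - 1) / 2) + real R <
      (real k - 2 * real g) * (real k - 2 * real g - 1) / 2"
    unfolding eventually_at_top_linorder by blast
  show ?thesis
  \<comment> \<open>The added summands keep all natural subtractions from being truncated.\<close>
  proof (intro exI[of _ "k1 + 2 + 2 * M + 2 * g"] allI impI conjI)
    fix k assume k: "k1 + 2 + 2 * M + 2 * g \<le> k"
    have "real M < real ((k - 2 * M) choose 2)"
      using k1(1)[of k] k by (simp add: real_choose_two of_nat_diff)
    then show "M < (k - 2 * M) choose 2" by simp
    show "39/50 * real ((k - 2) choose 2) + real R < real ((k - 2 * g) choose 2)"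
      using k1(2)[of k] k by (simp add: real_choose_two of_nat_diff)
  qed
qed

lemma (in sparse_graph) tau_eq:
  assumes k0: "\<And>k. k0 \<le> k \<Longrightarrow> R + R * R < (k - 2 * (R + R * R)) choose 2"
    "\<And>k. k0 \<le> k \<Longrightarrow> 39/50 * real ((k - 2) choose 2) + real R < real ((k - 2 * (R + d)) choose 2)"
    and n: "n > 0" and L: "real (k0\<^sup>2 + 1) \<le> 5/6 * L"
  shows "int (tau 2 n E) = \<lceil>(sqrt (8 * real (max_degree n E) + 1) + 5) / 2\<rceil>"
proof -
  let ?D = "max_degree n E"
  have D: "k0\<^sup>2 + 1 \<le> ?D" using L max_degree_ge by linarith
  have "(\<exists>f. tone_coloring 2 k n E f) \<longleftrightarrow> ?D \<le> (k - 2) choose 2" for k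
  proof
    assume "\<exists>f. tone_coloring 2 k n E f"
    then obtain f where f: "tone_coloring 2 k n E f" by blast
    have "?D \<in> degree E ` {0..<n}" unfolding max_degree_def using n by (intro Max_in) auto
    then show "?D \<le> (k - 2) choose 2" using tone_coloring_degree[OF f edges] by auto
  next
    assume le: "?D \<le> (k - 2) choose 2"
    \<comment> \<open>\<open>L\<close> is so large that the maximum degree exceeds the square of
      \<open>k0\<close>, whereas for smaller \<open>k\<close> the binomial is at most that
      square.\<close>
    have "k0 \<le> k"
    proof (rule ccontr)
      assume "\<not> ?thesis"
      then have "k \<le> k0" by simp
      have "(k - 2) choose 2 \<le> (k - 2) ^ 2" by (cases "2 \<le> k - 2") (auto intro: binomial_le_pow simp: binomial_eq_0)
      also have "\<dots> \<le> k0\<^sup>2" using \<open>k \<le> k0\<close> by (intro power_mono) auto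
      finally show False using D le by simp
    qed
    \<comment> \<open>13/20 = 39/50 * 5/6, and 5/6 L is at most the maximum degree.\<close>
    have "13/20 * L + real R \<le> 39/50 * real ((k - 2) choose 2) + real R"
      using le max_degree_ge by simp
    also have "\<dots> < real ((k - 2 * (R + d)) choose 2)" using k0(2)[OF \<open>k0 \<le> k\<close>] .
    finally show "\<exists>f. tone_coloring 2 k n E f"
      using color_all[OF k0(1)[OF \<open>k0 \<le> k\<close>] le] partial_coloring_imp_tone_coloring by blast
  qed
  then have "tau 2 n E = (LEAST k. \<lceil>(sqrt (8 * real ?D + 1) + 5) / 2\<rceil> \<le> int k)"
    unfolding tau_def using le_choose_two_iff[of ?D] D by simp
  also have "\<dots> = nat \<lceil>(sqrt (8 * real ?D + 1) + 5) / 2\<rceil>"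
    by (rule Least_int)
  finally have "tau 2 n E = nat \<lceil>(sqrt (8 * real ?D + 1) + 5) / 2\<rceil>" .
  moreover have "0 \<le> \<lceil>(sqrt (8 * real ?D + 1) + 5) / 2\<rceil>"
    unfolding zero_le_ceiling by (rule order_less_le_trans[of _ 0]) simp_all
  ultimately show ?thesis by (simp only: nat_0_le)
qed

section \<open>Probability estimates\<close>

text \<open>\<open>Gnp_prob\<close> over an arbitrary ground set: independence concerns disjoint
  sets of potential edges, and the binomial distribution is the case of an abstract set of given
  size.\<close>

definition edge_prob :: "real \<Rightarrow> 'a set \<Rightarrow> ('a set \<Rightarrow> bool) \<Rightarrow> real" where
  "edge_prob p S P = (\<Sum>E\<in>Pow S. if P E then p ^ card E * (1 - p) ^ (card S - card E) else 0)"

lemma Gnp_prob_conv: "Gnp_prob n p P = edge_prob p (all_edges n) P"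
  by (simp add: Gnp_prob_def edge_prob_def)

lemma edge_prob_cong: "(\<And>E. E \<subseteq> S \<Longrightarrow> P E = Q E) \<Longrightarrow> edge_prob p S P = edge_prob p S Q"
  unfolding edge_prob_def by (intro sum.cong) auto

text \<open>Independence of events on disjoint ground sets: subsets of the union correspond to pairs
  of subsets, and the weights multiply.\<close>

lemma edge_prob_Un:
  assumes "finite S" "finite S'" "S \<inter> S' = {}"
  shows "edge_prob p (S \<union> S') (\<lambda>E. P (E \<inter> S) \<and> Q (E \<inter> S')) = edge_prob p S P * edge_prob p S' Q"
proof -
  let ?w = "\<lambda>S P E. if P E then p ^ card E * (1 - p) ^ (card S - card E) else 0"
  have "edge_prob p S P * edge_prob p S' Q = (\<Sum>(A,B)\<in>Pow S \<times> Pow S'. ?w S P A * ?w S' Q B)"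
    by (simp only: edge_prob_def sum_product sum.cartesian_product)
  also have "\<dots> = (\<Sum>E\<in>Pow (S \<union> S'). ?w (S \<union> S') (\<lambda>E. P (E \<inter> S) \<and> Q (E \<inter> S')) E)"
  proof (rule sum.reindex_bij_witness[of _ "\<lambda>E. (E \<inter> S, E \<inter> S')" "\<lambda>(A,B). A \<union> B"], goal_cases)
    case (5 x)
    obtain A B where x: "x = (A,B)" "A \<subseteq> S" "B \<subseteq> S'" using 5 by auto
    have fin: "finite A" "finite B" using x assms by (auto intro: finite_subset)
    have c: "card (A \<union> B) = card A + card B" "card (S \<union> S') = card S + card S'"
      using x assms fin by (auto intro!: card_Un_disjoint)
    have le: "card A \<le> card S" "card B \<le> card S'" using x assms by (auto intro: card_mono)
    have "card S + card S' - (card A + card B) = (card S - card A) + (card S' - card B)" using le by simp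
    moreover have "(A \<union> B) \<inter> S = A" "(A \<union> B) \<inter> S' = B" using x assms by auto
    ultimately show ?case by (simp add: x(1) c power_add)
  qed (use assms in auto)
  finally show ?thesis by (simp add: edge_prob_def)
qed

lemma edge_prob_True: "finite S \<Longrightarrow> edge_prob p S (\<lambda>_. True) = 1"
proof (induction S rule: finite_induct)
  case (insert x S)
  have "edge_prob p {x} (\<lambda>_. True) = 1" by (simp add: edge_prob_def Pow_insert)
  then show ?case
    using insert edge_prob_Un[of "{x}" S p "\<lambda>_. True" "\<lambda>_. True"] by simp
qed (simp add: edge_prob_def)

lemma edge_prob_split:
  assumes "finite S" "S' \<subseteq> S"
  shows "edge_prob p S (\<lambda>E. P (E \<inter> S')) = edge_prob p S' P"
proof -
  have "finite S'" "finite (S - S')" "S' \<union> (S - S') = S" using assms finite_subset by auto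
  then show ?thesis
    using edge_prob_Un[of S' "S - S'" p P "\<lambda>_. True"] edge_prob_True[of "S - S'"] by auto
qed

lemma edge_prob_superset:
  assumes "finite S" "F \<subseteq> S"
  shows "edge_prob p S (\<lambda>E. F \<subseteq> E) = p ^ card F"
proof -
  have "finite F" using assms finite_subset by auto
  have "edge_prob p S (\<lambda>E. F \<subseteq> E) = edge_prob p S (\<lambda>E. F \<subseteq> E \<inter> F)" by (rule edge_prob_cong) auto
  also have "\<dots> = edge_prob p F (\<lambda>E. F \<subseteq> E)" by (rule edge_prob_split[OF assms])
  also have "\<dots> = (\<Sum>E\<in>{F}. p ^ card E * (1 - p) ^ (card F - card E))"
    unfolding edge_prob_def using \<open>finite F\<close> by (intro sum.mono_neutral_cong_right) auto
  finally show ?thesis by simp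
qed

lemma edge_prob_card:
  assumes "finite S"
  shows "edge_prob p S (\<lambda>E. card E = s) = real (card S choose s) * p ^ s * (1 - p) ^ (card S - s)"
proof -
  have "edge_prob p S (\<lambda>E. card E = s) = (\<Sum>E\<in>{E. E \<subseteq> S \<and> card E = s}. p ^ s * (1 - p) ^ (card S - s))"
    unfolding edge_prob_def using assms by (intro sum.mono_neutral_cong_right) auto
  then show ?thesis using n_subsets[OF assms, of s] by simp
qed

section \<open>Union bounds for random edge sets\<close>

context
  fixes p :: real
  assumes p: "0 \<le> p" "p \<le> 1"
begin

lemma edge_prob_nonneg: "0 \<le> edge_prob p S P"
  unfolding edge_prob_def using p by (intro sum_nonneg) auto

lemma edge_prob_union_bound:
  assumes "finite S" "finite I" "\<And>E. E \<subseteq> S \<Longrightarrow> P E \<Longrightarrow> \<exists>i\<in>I. Q i E"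
  shows "edge_prob p S P \<le> (\<Sum>i\<in>I. edge_prob p S (Q i))"
proof -
  let ?w = "\<lambda>E. p ^ card E * (1 - p) ^ (card S - card E)"
  have w: "0 \<le> ?w E" for E using p by simp
  have "(\<Sum>i\<in>I. edge_prob p S (Q i)) = (\<Sum>E\<in>Pow S. \<Sum>i\<in>I. if Q i E then ?w E else 0)"
    unfolding edge_prob_def by (rule sum.swap)
  moreover have "edge_prob p S P \<le> (\<Sum>E\<in>Pow S. \<Sum>i\<in>I. if Q i E then ?w E else 0)"
    unfolding edge_prob_def
  proof (rule sum_mono)
    fix E assume E: "E \<in> Pow S"
    show "(if P E then ?w E else 0) \<le> (\<Sum>i\<in>I. if Q i E then ?w E else 0)"
    proof (cases "P E")
      case True
      then obtain i where i: "i \<in> I" "Q i E" using assms(3) E by blast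
      then have "?w E = (\<Sum>i\<in>{i}. if Q i E then ?w E else 0)" by simp
      also have "\<dots> \<le> (\<Sum>i\<in>I. if Q i E then ?w E else 0)"
        using i w assms(2) by (intro sum_mono2) auto
      finally show ?thesis using True by simp
    qed (use w in \<open>auto intro!: sum_nonneg\<close>)
  qed
  ultimately show ?thesis by simp
qed

lemma edge_prob_mono:
  assumes "finite S" "\<And>E. E \<subseteq> S \<Longrightarrow> P E \<Longrightarrow> Q E"
  shows "edge_prob p S P \<le> edge_prob p S Q"
proof -
  have "edge_prob p S P \<le> (\<Sum>i\<in>{()}. edge_prob p S Q)"
    by (rule edge_prob_union_bound) (use assms in auto)
  then show ?thesis by simp
qed

lemma edge_prob_disj:
  assumes "finite S"
  shows "edge_prob p S (\<lambda>E. P E \<or> Q E) \<le> edge_prob p S P + edge_prob p S Q"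
proof -
  have "edge_prob p S (\<lambda>E. P E \<or> Q E) \<le> (\<Sum>b\<in>{True,False}. edge_prob p S (if b then P else Q))"
    by (rule edge_prob_union_bound) (use assms in auto)
  then show ?thesis by simp
qed

lemma edge_prob_not:
  assumes "finite S"
  shows "edge_prob p S (\<lambda>E. \<not> P E) = 1 - edge_prob p S P"
proof -
  have "edge_prob p S P + edge_prob p S (\<lambda>E. \<not> P E) = edge_prob p S (\<lambda>_. True)"
    unfolding edge_prob_def sum.distrib[symmetric] by (intro sum.cong) auto
  then show ?thesis using edge_prob_True[OF assms] by simp
qed

lemma edge_prob_le_1:
  assumes "finite S"
  shows "edge_prob p S P \<le> 1"
  using edge_prob_mono[OF assms, of P "\<lambda>_. True"] edge_prob_True[OF assms, of p] by simp

text \<open>The first moment method: every set with the property contains a certificate from the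
  family, and a certificate of size \<open>m\<close> is present with probability
  \<open>p ^ m\<close>.\<close>

lemma edge_prob_contains:
  assumes "finite S" "finite \<F>" "\<And>F. F \<in> \<F> \<Longrightarrow> F \<subseteq> S \<and> card F = m"
    "\<And>E. E \<subseteq> S \<Longrightarrow> P E \<Longrightarrow> \<exists>F\<in>\<F>. F \<subseteq> E"
  shows "edge_prob p S P \<le> real (card \<F>) * p ^ m"
proof -
  have "edge_prob p S P \<le> (\<Sum>F\<in>\<F>. edge_prob p S (\<lambda>E. F \<subseteq> E))"
    using assms by (intro edge_prob_union_bound) auto
  also have "\<dots> = (\<Sum>F\<in>\<F>. p ^ m)" using assms by (intro sum.cong) (auto simp: edge_prob_superset)
  finally show ?thesis by simp
qed

end

section \<open>First moment bounds for dense vertex sets\<close>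

definition pairs_in :: "nat set \<Rightarrow> nat set set" where
  "pairs_in T = {e. \<exists>u\<in>T. \<exists>v\<in>T. u < v \<and> e = {u,v}}"

text \<open>The potential edges leaving \<open>T\<close>. They are disjoint from the pairs inside
  \<open>T\<close>, so a certificate can contain inner edges and outgoing edges without counting any
  of them twice.\<close>

definition cut :: "nat \<Rightarrow> nat set \<Rightarrow> nat set set" where
  "cut n T = (\<lambda>(u,v). {u,v}) ` (T \<times> ({..<n} - T))"

lemma card_pairs_in:
  assumes "finite T"
  shows "finite (pairs_in T)" "card (pairs_in T) \<le> (card T)\<^sup>2"
proof -
  have sub: "pairs_in T \<subseteq> (\<lambda>(u,v). {u,v}) ` (T \<times> T)" by (auto simp: pairs_in_def)
  then show "finite (pairs_in T)" using assms by (auto intro: finite_subset)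
  have "card (pairs_in T) \<le> card ((\<lambda>(u,v). {u,v}) ` (T \<times> T))" using sub assms by (intro card_mono) auto
  also have "\<dots> \<le> card (T \<times> T)" using assms by (intro card_image_le) auto
  finally show "card (pairs_in T) \<le> (card T)\<^sup>2" by (simp add: card_cartesian_product power2_eq_square)
qed

lemma pairs_in_subset: "T \<subseteq> {..<n} \<Longrightarrow> pairs_in T \<subseteq> all_edges n"
proof
  fix e assume "T \<subseteq> {..<n}" "e \<in> pairs_in T"
  then obtain u v where "v \<in> {..<n}" "u < v" "e = {u,v}" unfolding pairs_in_def by blast
  then show "e \<in> all_edges n" unfolding all_edges_def by blast
qed

lemma inner_edges_eq: "E \<subseteq> all_edges n \<Longrightarrow> inner_edges E T = E \<inter> pairs_in T"
proof -
  assume E: "E \<subseteq> all_edges n"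
  have "e \<subseteq> T \<longleftrightarrow> e \<in> pairs_in T" if "e \<in> E" for e
  proof -
    have "e \<in> all_edges n" using that E by blast
    then obtain u v where "u < v" "e = {u,v}" by (auto simp: all_edges_def)
    then show ?thesis by (auto simp: pairs_in_def)
  qed
  then show ?thesis by (auto simp: inner_edges_def)
qed

lemma cut_subset:
  assumes "T \<subseteq> {..<n}"
  shows "cut n T \<subseteq> all_edges n"
proof
  fix e assume "e \<in> cut n T"
  then obtain u v where e: "e = {u,v}" "u \<in> T" "v < n" "v \<notin> T" by (auto simp: cut_def)
  then have "u < n" "u \<noteq> v" using assms by auto
  then consider "u < v" | "v < u" by linarith
  then show "e \<in> all_edges n"
  proof cases
    case 1
    then show ?thesis using e unfolding all_edges_def by blast
  next
    case 2
    then have "v < u \<and> u < n \<and> e = {v,u}" using e \<open>u < n\<close> by (simp add: insert_commute)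
    then show ?thesis unfolding all_edges_def by blast
  qed
qed

lemma card_cut:
  assumes "finite T"
  shows "finite (cut n T)" "card (cut n T) \<le> card T * n"
proof -
  show "finite (cut n T)" unfolding cut_def using assms by auto
  have "card (cut n T) \<le> card (T \<times> ({..<n} - T))" unfolding cut_def using assms by (intro card_image_le) auto
  also have "\<dots> \<le> card (T \<times> {..<n})" using assms by (intro card_mono) auto
  finally show "card (cut n T) \<le> card T * n" by (simp add: card_cartesian_product)
qed

lemma cut_inter_pairs_in: "cut n T \<inter> pairs_in T = {}"
proof -
  have "e \<subseteq> T" if "e \<in> pairs_in T" for e using that by (auto simp: pairs_in_def)
  moreover have "\<not> e \<subseteq> T" if "e \<in> cut n T" for e using that by (auto simp: cut_def)
  ultimately show ?thesis by blast
qed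

text \<open>Each vertex of \<open>T\<close> has at most \<open>card T\<close> neighbors inside
  \<open>T\<close>. Each of its other neighbors gives a cut edge, and a cut edge has only one end in
  \<open>T\<close>.\<close>

lemma degree_sum_le_cut:
  assumes E: "E \<subseteq> all_edges n" and T: "T \<subseteq> {..<n}"
  shows "(\<Sum>v\<in>T. degree E v) \<le> card (E \<inter> cut n T) + (card T)\<^sup>2"
proof -
  have fin: "finite T" using T finite_subset by auto
  have finE: "finite E" using E finite_all_edges finite_subset by auto
  let ?O = "\<lambda>v. {w. adj E v w} - T"
  have "degree E v \<le> card (?O v) + card T" for v
  proof -
    have "{w. adj E v w} \<subseteq> ?O v \<union> T" by auto
    then have "degree E v \<le> card (?O v \<union> T)"
      unfolding degree_conv_adj using finite_nbrs[OF E] fin by (intro card_mono) auto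
    also have "\<dots> \<le> card (?O v) + card T" by (rule card_Un_le)
    finally show ?thesis .
  qed
  then have "(\<Sum>v\<in>T. degree E v) \<le> (\<Sum>v\<in>T. card (?O v) + card T)" by (intro sum_mono)
  also have "\<dots> = card (Sigma T ?O) + (card T)\<^sup>2"
    using fin finite_nbrs[OF E] by (simp add: sum.distrib power2_eq_square)
  also have "card (Sigma T ?O) \<le> card (E \<inter> cut n T)"
  proof (rule card_inj_on_le[of "\<lambda>(v,w). {v,w}"])
    show "inj_on (\<lambda>(v,w). {v,w}) (Sigma T ?O)"
    proof (rule inj_onI)
      fix x y assume "x \<in> Sigma T ?O" "y \<in> Sigma T ?O" "(\<lambda>(v,w). {v,w}) x = (\<lambda>(v,w). {v,w}) y"
      then show "x = y" by (cases x, cases y) (auto simp: doubleton_eq_iff)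
    qed
    show "(\<lambda>(v,w). {v,w}) ` Sigma T ?O \<subseteq> E \<inter> cut n T"
    proof
      fix e assume "e \<in> (\<lambda>(v,w). {v,w}) ` Sigma T ?O"
      then obtain v w where vw: "e = {v,w}" "v \<in> T" "adj E v w" "w \<notin> T" by auto
      have "w < n" using adj_bound(2)[OF E vw(3)] .
      then have "e \<in> cut n T" unfolding cut_def using vw by (intro image_eqI[of _ _ "(v,w)"]) auto
      moreover have "e \<in> E" using vw by (simp add: adj_def)
      ultimately show "e \<in> E \<inter> cut n T" by blast
    qed
    show "finite (E \<inter> cut n T)" using finE by simp
  qed
  finally show ?thesis by simp
qed

text \<open>A certificate consists of \<open>j\<close> pairs inside \<open>T\<close> and
  \<open>m\<close> pairs leaving it. The first two factors crudely count the sets \<open>T\<close>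
  and the inner parts, which is enough for bounded \<open>t\<close>; the offset
  \<open>t\<^sup>2\<close> pays for degrees inside \<open>T\<close>.\<close>

lemma prob_dense_large_degree:
  assumes p: "0 \<le> p" "p \<le> 1"
  shows "Gnp_prob n p (\<lambda>E. \<exists>T\<subseteq>{..<n}. card T = t \<and> j \<le> card (inner_edges E T) \<and>
      m + t\<^sup>2 \<le> (\<Sum>v\<in>T. degree E v)) \<le> real n ^ t * 2 ^ (t\<^sup>2) * real ((t * n) choose m) * p ^ (j + m)"
    (is "Gnp_prob n p ?P \<le> _")
proof -
  define \<T> where "\<T> = {T. T \<subseteq> {..<n} \<and> card T = t}"
  define \<A> where "\<A> T = {A. A \<subseteq> pairs_in T \<and> card A = j}" for T
  define \<B> where "\<B> T = {B. B \<subseteq> cut n T \<and> card B = m}" for T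
  define \<F> where "\<F> = (\<lambda>(T,A,B). A \<union> B) ` (SIGMA T:\<T>. \<A> T \<times> \<B> T)"
  have fT: "finite \<T>" unfolding \<T>_def by (rule finite_subset[of _ "Pow {..<n}"]) auto
  have T: "finite T" if "T \<in> \<T>" for T using that by (auto simp: \<T>_def intro: finite_subset)
  have fA: "finite (\<A> T)" "finite (\<B> T)" if "T \<in> \<T>" for T
    using card_pairs_in(1)[OF T[OF that]] card_cut(1)[OF T[OF that], of n] by (auto simp: \<A>_def \<B>_def)
  have cA: "card (\<A> T \<times> \<B> T) \<le> 2 ^ (t\<^sup>2) * ((t * n) choose m)" if "T \<in> \<T>" for T
  proof -
    have c: "card T = t" using that by (simp add: \<T>_def)
    have "card (\<A> T) \<le> card (Pow (pairs_in T))"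
      using card_pairs_in(1)[OF T[OF that]] by (intro card_mono) (auto simp: \<A>_def)
    also have "\<dots> \<le> 2 ^ (t\<^sup>2)" using card_pairs_in[OF T[OF that]] c by (simp add: card_Pow)
    finally have 1: "card (\<A> T) \<le> 2 ^ (t\<^sup>2)" .
    have "card (\<B> T) = card (cut n T) choose m"
      unfolding \<B>_def by (rule n_subsets[OF card_cut(1)[OF T[OF that]]])
    also have "\<dots> \<le> (t * n) choose m" using card_cut(2)[OF T[OF that], of n] c by (intro binomial_right_mono) simp
    finally show ?thesis using 1 by (simp add: card_cartesian_product mult_le_mono)
  qed
  have fS: "finite (SIGMA T:\<T>. \<A> T \<times> \<B> T)" using fT fA by auto
  have "card \<F> \<le> card (SIGMA T:\<T>. \<A> T \<times> \<B> T)" unfolding \<F>_def by (rule card_image_le[OF fS])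
  also have "\<dots> = (\<Sum>T\<in>\<T>. card (\<A> T \<times> \<B> T))" using fT fA by (intro card_SigmaI) auto
  also have "\<dots> \<le> (\<Sum>T\<in>\<T>. 2 ^ (t\<^sup>2) * ((t * n) choose m))" by (intro sum_mono cA)
  also have "\<dots> = (n choose t) * (2 ^ (t\<^sup>2) * ((t * n) choose m))"
    using n_subsets[of "{..<n}" t] by (simp add: \<T>_def)
  also have "\<dots> \<le> n ^ t * (2 ^ (t\<^sup>2) * ((t * n) choose m))"
    by (cases "t \<le> n") (auto intro: mult_right_mono binomial_le_pow simp: binomial_eq_0)
  finally have "card \<F> \<le> n ^ t * 2 ^ (t\<^sup>2) * ((t * n) choose m)" by simp
  then have "real (card \<F>) \<le> real (n ^ t * 2 ^ (t\<^sup>2) * ((t * n) choose m))" by (rule of_nat_mono)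
  then have cF: "real (card \<F>) \<le> real n ^ t * 2 ^ (t\<^sup>2) * real ((t * n) choose m)" by simp
  have "edge_prob p (all_edges n) ?P \<le> real (card \<F>) * p ^ (j + m)"
  proof (rule edge_prob_contains[OF p finite_all_edges])
    show "finite \<F>" unfolding \<F>_def using fS by simp
    show "F \<subseteq> all_edges n \<and> card F = j + m" if "F \<in> \<F>" for F
    proof -
      obtain T A B where F: "F = A \<union> B" "T \<in> \<T>" "A \<in> \<A> T" "B \<in> \<B> T" using \<open>F \<in> \<F>\<close> by (auto simp: \<F>_def)
      have Tn: "T \<subseteq> {..<n}" using F by (simp add: \<T>_def)
      have AB: "A \<subseteq> pairs_in T" "B \<subseteq> cut n T" "card A = j" "card B = m" using F by (auto simp: \<A>_def \<B>_def)
      then have "finite A" "finite B" "A \<inter> B = {}"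
        using card_pairs_in(1)[OF T[OF F(2)]] card_cut(1)[OF T[OF F(2)], of n] cut_inter_pairs_in[of n T]
        by (auto intro: finite_subset)
      then have "card F = j + m" using F AB by (simp add: card_Un_disjoint)
      then show ?thesis using AB F pairs_in_subset[OF Tn] cut_subset[OF Tn] by auto
    qed
    show "\<exists>F\<in>\<F>. F \<subseteq> E" if E: "E \<subseteq> all_edges n" and P: "?P E" for E
    proof -
      obtain T where T': "T \<subseteq> {..<n}" "card T = t" "j \<le> card (inner_edges E T)"
        "m + t\<^sup>2 \<le> (\<Sum>v\<in>T. degree E v)" using P by blast
      obtain A where A: "A \<subseteq> E \<inter> pairs_in T" "card A = j"
        using T'(3) obtain_subset_with_card_n inner_edges_eq[OF E] by metis
      have "m \<le> card (E \<inter> cut n T)" using degree_sum_le_cut[OF E T'(1)] T' by simp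
      then obtain B where B: "B \<subseteq> E \<inter> cut n T" "card B = m"
        using obtain_subset_with_card_n by metis
      have "A \<union> B \<in> \<F>" unfolding \<F>_def
        using T' A B by (intro image_eqI[of _ _ "(T,A,B)"]) (auto simp: \<T>_def \<A>_def \<B>_def)
      then show ?thesis using A B by blast
    qed
  qed
  also have "\<dots> \<le> real n ^ t * 2 ^ (t\<^sup>2) * real ((t * n) choose m) * p ^ (j + m)"
    using cF p by (intro mult_right_mono) auto
  finally show ?thesis by (simp add: Gnp_prob_conv)
qed

text \<open>Here the set may be as large as the whole graph, so both binomials are kept instead of
  the crude counts used for bounded sets.\<close>

lemma prob_dense:
  assumes p: "0 \<le> p" "p \<le> 1"
  shows "Gnp_prob n p (\<lambda>E. \<exists>U\<subseteq>{..<n}. card U = s \<and> j \<le> card (inner_edges E U))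
    \<le> real (n choose s) * real (s\<^sup>2 choose j) * p ^ j"
    (is "Gnp_prob n p ?P \<le> _")
proof -
  define \<T> where "\<T> = {T. T \<subseteq> {..<n} \<and> card T = s}"
  define \<F> where "\<F> = (\<Union>T\<in>\<T>. {A. A \<subseteq> pairs_in T \<and> card A = j})"
  have fT: "finite \<T>" unfolding \<T>_def by (rule finite_subset[of _ "Pow {..<n}"]) auto
  have T: "finite T" if "T \<in> \<T>" for T using that by (auto simp: \<T>_def intro: finite_subset)
  have "card \<F> \<le> (\<Sum>T\<in>\<T>. card {A. A \<subseteq> pairs_in T \<and> card A = j})" unfolding \<F>_def by (rule card_UN_le[OF fT])
  also have "\<dots> \<le> (\<Sum>T\<in>\<T>. (s\<^sup>2 choose j))"
  proof (rule sum_mono)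
    fix T assume t: "T \<in> \<T>"
    show "card {A. A \<subseteq> pairs_in T \<and> card A = j} \<le> s\<^sup>2 choose j"
      using card_pairs_in[OF T[OF t]] t
      by (subst n_subsets) (auto simp: \<T>_def intro: binomial_right_mono)
  qed
  also have "\<dots> = (n choose s) * (s\<^sup>2 choose j)" using n_subsets[of "{..<n}" s] by (simp add: \<T>_def)
  finally have "real (card \<F>) \<le> real ((n choose s) * (s\<^sup>2 choose j))" by (rule of_nat_mono)
  then have cF: "real (card \<F>) \<le> real (n choose s) * real (s\<^sup>2 choose j)" by simp
  have "edge_prob p (all_edges n) ?P \<le> real (card \<F>) * p ^ j"
  proof (rule edge_prob_contains[OF p finite_all_edges])
    show "finite \<F>" unfolding \<F>_def using fT card_pairs_in(1)[OF T] by auto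
    show "F \<subseteq> all_edges n \<and> card F = j" if "F \<in> \<F>" for F
      using that pairs_in_subset[of _ n] by (auto simp: \<F>_def \<T>_def)
    show "\<exists>F\<in>\<F>. F \<subseteq> E" if E: "E \<subseteq> all_edges n" and P: "?P E" for E
    proof -
      obtain T where T': "T \<subseteq> {..<n}" "card T = s" "j \<le> card (inner_edges E T)" using P by blast
      obtain A where A: "A \<subseteq> E \<inter> pairs_in T" "card A = j"
        using T'(3) obtain_subset_with_card_n inner_edges_eq[OF E] by metis
      then have "A \<in> \<F>" using T' by (auto simp: \<F>_def \<T>_def)
      then show ?thesis using A by blast
    qed
  qed
  also have "\<dots> \<le> real (n choose s) * real (s\<^sup>2 choose j) * p ^ j"
    using cF p by (intro mult_right_mono) auto
  finally show ?thesis by (simp add: Gnp_prob_conv)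
qed

text \<open>The stars from the first \<open>h\<close> vertices into the remaining ones are pairwise disjoint, so they
  are independent.\<close>
lemma prob_max_degree_less:
  assumes p: "0 \<le> p" "p \<le> 1" and h: "h \<le> n"
  shows "Gnp_prob n p (\<lambda>E. \<forall>v<h. degree E v < s)
    \<le> (1 - real ((n - h) choose s) * p ^ s * (1 - p) ^ (n - h - s)) ^ h"
proof -
  define Q where "Q v = (\<lambda>b. {v,b}) ` {h..<n}" for v
  have Q: "finite (Q v)" "card (Q v) = n - h" if "v < h" for v
  proof -
    show "finite (Q v)" by (simp add: Q_def)
    have "inj_on (\<lambda>b. {v,b}) {h..<n}" by (auto simp: inj_on_def doubleton_eq_iff)
    then show "card (Q v) = n - h" by (simp add: Q_def card_image)
  qed
  have prod: "edge_prob p (\<Union>v<j. Q v) (\<lambda>E. \<forall>v<j. card (E \<inter> Q v) < s)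
      = (\<Prod>v<j. edge_prob p (Q v) (\<lambda>E. card E < s))" if "j \<le> h" for j
    using that
  proof (induction j)
    case 0
    then show ?case by (simp add: edge_prob_def)
  next
    case (Suc j)
    have dis: "(\<Union>v<j. Q v) \<inter> Q j = {}" using Suc by (auto simp: Q_def doubleton_eq_iff)
    have fin: "finite (\<Union>v<j. Q v)" "finite (Q j)" by (auto simp: Q_def)
    have "edge_prob p (\<Union>v<Suc j. Q v) (\<lambda>E. \<forall>v<Suc j. card (E \<inter> Q v) < s)
      = edge_prob p ((\<Union>v<j. Q v) \<union> Q j) (\<lambda>E. (\<forall>v<j. card ((E \<inter> (\<Union>v<j. Q v)) \<inter> Q v) < s) \<and> card (E \<inter> Q j) < s)"
    proof -
      have "(\<Union>v<Suc j. Q v) = (\<Union>v<j. Q v) \<union> Q j" by (auto simp: less_Suc_eq)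
      moreover have "(E \<inter> (\<Union>v<j. Q v)) \<inter> Q v = E \<inter> Q v" if "v < j" for E v using that by auto
      ultimately show ?thesis by (auto simp: less_Suc_eq intro!: edge_prob_cong)
    qed
    also have "\<dots> = edge_prob p (\<Union>v<j. Q v) (\<lambda>E. \<forall>v<j. card (E \<inter> Q v) < s) * edge_prob p (Q j) (\<lambda>E. card E < s)"
      by (rule edge_prob_Un[OF fin dis])
    finally show ?case using Suc by simp
  qed
  define q where "q = real ((n - h) choose s) * p ^ s * (1 - p) ^ (n - h - s)"
  have q: "edge_prob p (Q v) (\<lambda>E. card E < s) \<le> 1 - q" if "v < h" for v
  proof -
    \<comment> \<open>Excluding only the value \<open>s\<close> instead of all values from
      \<open>s\<close> on leaves a single explicit binomial term.\<close>
    have "edge_prob p (Q v) (\<lambda>E. card E < s) \<le> edge_prob p (Q v) (\<lambda>E. \<not> card E = s)"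
      by (rule edge_prob_mono[OF p Q(1)[OF that]]) auto
    also have "\<dots> = 1 - q"
      unfolding q_def using Q[OF that] by (simp add: edge_prob_not[OF p] edge_prob_card)
    finally show ?thesis .
  qed
  have S: "(\<Union>v<h. Q v) \<subseteq> all_edges n"
  proof
    fix e assume "e \<in> (\<Union>v<h. Q v)"
    then obtain v b where "v < h" "h \<le> b" "b < n" "e = {v,b}" by (auto simp: Q_def)
    then have "v < b" "b < n" "e = {v,b}" by auto
    then show "e \<in> all_edges n" unfolding all_edges_def by blast
  qed
  have "Gnp_prob n p (\<lambda>E. \<forall>v<h. degree E v < s)
      \<le> edge_prob p (all_edges n) (\<lambda>E. \<forall>v<h. card ((E \<inter> (\<Union>v<h. Q v)) \<inter> Q v) < s)"
    unfolding Gnp_prob_conv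
  proof (rule edge_prob_mono[OF p finite_all_edges], intro allI impI)
    fix E v assume E: "E \<subseteq> all_edges n" and d: "\<forall>v<h. degree E v < s" and v: "v < h"
    have "E \<inter> Q v \<subseteq> (\<lambda>b. {v,b}) ` {w. adj E v w}"
    proof
      fix e assume "e \<in> E \<inter> Q v"
      then obtain b where b: "e = {v,b}" "h \<le> b" "e \<in> E" by (auto simp: Q_def)
      then have "adj E v b" using v by (auto simp: adj_def)
      then show "e \<in> (\<lambda>b. {v,b}) ` {w. adj E v w}" using b by blast
    qed
    then have "card (E \<inter> Q v) \<le> card ((\<lambda>b. {v,b}) ` {w. adj E v w})"
      using finite_nbrs[OF E] by (intro card_mono) auto
    also have "\<dots> \<le> degree E v" unfolding degree_conv_adj using finite_nbrs[OF E] by (intro card_image_le)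
    finally have "card (E \<inter> Q v) < s" using d v by (meson le_less_trans)
    moreover have "(E \<inter> (\<Union>v<h. Q v)) \<inter> Q v = E \<inter> Q v" using v by auto
    ultimately show "card ((E \<inter> (\<Union>v<h. Q v)) \<inter> Q v) < s" by simp
  qed
  also have "\<dots> = (\<Prod>v<h. edge_prob p (Q v) (\<lambda>E. card E < s))"
    using prod[of h] edge_prob_split[OF finite_all_edges S, of p "\<lambda>E. \<forall>v<h. card (E \<inter> Q v) < s"] by simp
  also have "\<dots> \<le> (\<Prod>v<h. 1 - q)" by (intro prod_mono) (auto simp: q edge_prob_nonneg[OF p])
  finally show ?thesis by (simp add: q_def)
qed

section \<open>Asymptotics\<close>

text \<open>A single term of the exponential series is at most the whole sum. With
  \<open>x = m\<close> it yields the weak form of Stirling's bound used next.\<close>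

lemma power_le_fact_mult_exp:
  fixes x :: real
  assumes "0 \<le> x"
  shows "x ^ m \<le> fact m * exp x"
proof -
  have "(\<Sum>i\<in>{m}. x ^ i /\<^sub>R fact i) \<le> (\<Sum>i. x ^ i /\<^sub>R fact i)"
    using exp_converges[of x] assms by (intro sum_le_suminf) (auto simp: sums_iff)
  then have "x ^ m / fact m \<le> exp x" using exp_converges[of x] by (simp add: sums_iff field_simps)
  then show ?thesis by (simp add: field_simps)
qed

lemma power_div_fact_le:
  assumes "0 \<le> x" "m > 0"
  shows "x ^ m / fact m \<le> (exp 1 * x / real m) ^ m"
proof -
  have "real m ^ m \<le> fact m * exp 1 ^ m" using power_le_fact_mult_exp[of "real m" m] by (simp add: exp_of_nat_mult[symmetric])
  then have "x ^ m * real m ^ m \<le> x ^ m * (fact m * exp 1 ^ m)" using assms by (intro mult_left_mono) auto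
  then show ?thesis using assms by (simp add: power_divide power_mult_distrib field_simps)
qed

lemma binomial_le_power_div_fact: "real (N choose m) \<le> real N ^ m / fact m"
proof -
  have "real ((N choose m) * fact m) \<le> real (N ^ m)" by (rule of_nat_mono[OF binomial_fact_pow])
  then show ?thesis by (simp add: field_simps)
qed

definition log_ratio :: "nat \<Rightarrow> real" where
  "log_ratio n = ln (real n) / ln (ln (real n))"

lemma log_ratio_at_top: "filterlim log_ratio at_top at_top"
  unfolding log_ratio_def by real_asymp

text \<open>For m \<ge> 6/5 L the logarithm of \<open>fact m\<close> is asymptotically at least 6/5
  ln n, because ln L is asymptotic to ln (ln n). This beats the factor n and the power of
  \<open>K\<close>; any constant above 1 in place of 6/5 would have the same effect.\<close>

lemma mult_power_div_fact_tendsto_0: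
  assumes K: "K > 0" and m: "eventually (\<lambda>n. 6/5 * log_ratio n \<le> real (m n)) at_top"
  shows "(\<lambda>n. real n * K ^ m n / fact (m n)) \<longlonglongrightarrow> 0"
proof (rule Lim_null_comparison)
  let ?x = "\<lambda>n. 6/5 * log_ratio n"
  show "(\<lambda>n::nat. exp (ln (real n) - ?x n * (ln (?x n) - (1 + ln K)))) \<longlonglongrightarrow> 0"
    unfolding log_ratio_def by real_asymp
  have "filterlim (\<lambda>n. ln (?x n)) at_top at_top" unfolding log_ratio_def by real_asymp
  then have "eventually (\<lambda>n. 1 + ln K \<le> ln (?x n)) at_top" by (simp add: filterlim_at_top)
  moreover have "eventually (\<lambda>n. 1 \<le> ?x n) at_top" unfolding log_ratio_def by real_asymp
  ultimately show "eventually (\<lambda>n. norm (real n * K ^ m n / fact (m n)) \<le>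
      exp (ln (real n) - ?x n * (ln (?x n) - (1 + ln K)))) at_top"
    using m eventually_gt_at_top[of 0]
  proof eventually_elim
    case (elim n)
    define M where "M = real (m n)"
    have M: "?x n \<le> M" "1 \<le> M" using elim by (auto simp: M_def)
    have "m n > 0" using M by (simp add: M_def)
    have "norm (real n * K ^ m n / fact (m n)) = real n * (K ^ m n / fact (m n))" using K by simp
    also have "\<dots> \<le> real n * (exp 1 * K / M) ^ m n"
      unfolding M_def using power_div_fact_le[of K "m n"] K \<open>m n > 0\<close> by (intro mult_left_mono) auto
    also have "\<dots> = exp (ln (real n) - M * (ln M - (1 + ln K)))"
    proof -
      have "exp 1 * K / M = exp (- (ln M - (1 + ln K)))" using K M by (simp add: exp_diff exp_add)
      then have "(exp 1 * K / M) ^ m n = exp (- (M * (ln M - (1 + ln K))))"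
        by (simp add: M_def exp_of_nat_mult[symmetric] algebra_simps)
      moreover have "real n = exp (ln (real n))" using elim by simp
      ultimately show ?thesis using exp_add[of "ln (real n)" "- (M * (ln M - (1 + ln K)))"] by simp
    qed
    also have "\<dots> \<le> exp (ln (real n) - ?x n * (ln (?x n) - (1 + ln K)))"
    proof -
      \<comment> \<open>Only a lower bound on \<open>m n\<close> is known. The exponent is monotone
        in it because the factor ln M - (1 + ln K) is already nonnegative at
        \<open>?x n\<close>.\<close>
      have "ln (?x n) \<le> ln M" using M elim by simp
      then have "?x n * (ln (?x n) - (1 + ln K)) \<le> M * (ln M - (1 + ln K))"
        using M elim by (intro mult_mono) auto
      then show ?thesis by simp
    qed
    finally show ?case .
  qed
qed

lemma power_div_fact_tendsto_0:
  assumes "filterlim m at_top F"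
  shows "((\<lambda>n. K ^ m n / fact (m n) :: real) \<longlongrightarrow> 0) F"
proof -
  have "(\<lambda>n. K ^ n /\<^sub>R fact n) \<longlonglongrightarrow> 0"
    using exp_converges[of K] by (intro summable_LIMSEQ_zero) (auto simp: sums_iff)
  then have "(\<lambda>n. K ^ n / fact n) \<longlonglongrightarrow> 0" by (simp add: field_simps)
  from filterlim_compose[OF this assms] show ?thesis .
qed

text \<open>The powers of n cancel: \<open>j\<close> inner edges leave n ^ (t - j) of the choices of
  \<open>T\<close>, and the cut edges contribute (t n) ^ m * (c / n) ^ m = (t c) ^ m. The base
  \<open>1 + c\<close> makes the bound uniform in \<open>t\<close>, also for c < 1.\<close>

lemma Gnp_prob_dense_bound:
  assumes n: "n > 0" and c: "0 < c" "c \<le> real n" and t: "t \<le> t0" and j: "j \<le> t"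
  shows "Gnp_prob n (c / real n) (\<lambda>E. \<exists>T\<subseteq>{..<n}. card T = t \<and> j \<le> card (inner_edges E T) \<and>
      m + t\<^sup>2 \<le> (\<Sum>v\<in>T. degree E v))
    \<le> real n ^ (t - j) * ((1 + c) ^ t0 * 2 ^ (t0\<^sup>2) * ((t0 * c) ^ m / fact m))"
    (is "?P \<le> _")
proof -
  let ?p = "c / real n"
  have "?P \<le> real n ^ t * 2 ^ (t\<^sup>2) * real ((t * n) choose m) * ?p ^ (j + m)"
    using n c by (intro prob_dense_large_degree) (auto simp: field_simps)
  also have "\<dots> \<le> real n ^ t * 2 ^ (t\<^sup>2) * (real (t * n) ^ m / fact m) * ?p ^ (j + m)"
    using c by (intro mult_right_mono mult_left_mono binomial_le_power_div_fact) auto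
  also have "\<dots> = real n ^ (t - j) * (c ^ j * 2 ^ (t\<^sup>2) * ((t * c) ^ m / fact m))"
  proof -
    have "real n ^ t = real n ^ (t - j) * real n ^ j" using j by (simp add: power_add[symmetric])
    then show ?thesis using n by (simp add: power_add power_divide power_mult_distrib field_simps)
  qed
  also have "\<dots> \<le> real n ^ (t - j) * ((1 + c) ^ t0 * 2 ^ (t0\<^sup>2) * ((t0 * c) ^ m / fact m))"
  proof (intro mult_left_mono mult_mono divide_right_mono power_mono)
    have "c ^ j \<le> (1 + c) ^ j" using c by (intro power_mono) auto
    also have "\<dots> \<le> (1 + c) ^ t0" using c t j by (intro power_increasing) auto
    finally show "c ^ j \<le> (1 + c) ^ t0" .
    show "(2::real) ^ (t\<^sup>2) \<le> 2 ^ (t0\<^sup>2)" using t by (intro power_increasing power_mono) auto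
  qed (use t c in auto)
  finally show ?thesis .
qed

text \<open>\<open>r = 1\<close> covers tree-like sets, which cost a factor n, and
  \<open>r = 0\<close> covers sets with a cycle, which cost none. As T is nonempty, t - (t - r) is
  exactly \<open>r\<close> without truncation.\<close>

lemma Gnp_prob_dense_bound_Ex:
  assumes n: "n > 0" and c: "0 < c" "c \<le> real n" and r: "r \<le> 1"
  shows "Gnp_prob n (c / real n) (\<lambda>E. \<exists>T\<subseteq>{..<n}. T \<noteq> {} \<and> card T \<le> t0 \<and> card T \<le> card (inner_edges E T) + r \<and>
      m + t0\<^sup>2 \<le> (\<Sum>v\<in>T. degree E v))
    \<le> real t0 * (real n ^ r * ((1 + c) ^ t0 * 2 ^ (t0\<^sup>2) * ((t0 * c) ^ m / fact m)))"
    (is "Gnp_prob n ?p ?P \<le> _")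
proof -
  let ?Q = "\<lambda>t E. \<exists>T\<subseteq>{..<n}. card T = t \<and> t - r \<le> card (inner_edges E T) \<and> m + t\<^sup>2 \<le> (\<Sum>v\<in>T. degree E v)"
  have p: "0 \<le> ?p" "?p \<le> 1" using n c by auto
  have "Gnp_prob n ?p ?P \<le> (\<Sum>t\<in>{1..t0}. Gnp_prob n ?p (?Q t))"
    unfolding Gnp_prob_conv
  proof (rule edge_prob_union_bound[OF p finite_all_edges])
    fix E assume "?P E"
    then obtain T where T: "T \<subseteq> {..<n}" "T \<noteq> {}" "card T \<le> t0" "card T \<le> card (inner_edges E T) + r"
        "m + t0\<^sup>2 \<le> (\<Sum>v\<in>T. degree E v)" by blast
    have "finite T" using T finite_subset by auto
    then have 1: "card T \<in> {1..t0}" using T by (simp add: Suc_le_eq card_gt_0_iff)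
    have "(card T)\<^sup>2 \<le> t0\<^sup>2" using T by (intro power_mono) auto
    then have "m + (card T)\<^sup>2 \<le> (\<Sum>v\<in>T. degree E v)" using T(5) by linarith
    then have "?Q (card T) E" using T by (intro exI[of _ T]) auto
    then show "\<exists>t\<in>{1..t0}. ?Q t E" using 1 by blast
  qed simp
  also have "\<dots> \<le> (\<Sum>t\<in>{1..t0}. real n ^ r * ((1 + c) ^ t0 * 2 ^ (t0\<^sup>2) * ((t0 * c) ^ m / fact m)))"
  proof (rule sum_mono)
    fix t assume t: "t \<in> {1..t0}"
    have "t - (t - r) = r" using t r by auto
    then show "Gnp_prob n ?p (?Q t) \<le> real n ^ r * ((1 + c) ^ t0 * 2 ^ (t0\<^sup>2) * ((t0 * c) ^ m / fact m))"
      using Gnp_prob_dense_bound[OF n c, of t t0 "t - r" m] t by simp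
  qed
  finally show ?thesis by simp
qed

section \<open>Vanishing probability of the exceptional events\<close>

lemma Gnp_prob_mono:
  assumes "n > 0" "0 < c" "c \<le> real n" "\<And>E. E \<subseteq> all_edges n \<Longrightarrow> P E \<Longrightarrow> Q E"
  shows "Gnp_prob n (c / real n) P \<le> Gnp_prob n (c / real n) Q"
  unfolding Gnp_prob_conv using assms by (intro edge_prob_mono finite_all_edges) auto

lemma Gnp_prob_nonneg:
  assumes "n > 0" "0 < c" "c \<le> real n"
  shows "0 \<le> Gnp_prob n (c / real n) P"
  unfolding Gnp_prob_conv using assms by (intro edge_prob_nonneg) auto

lemma large_nat_ceiling:
  assumes "a > 0"
  shows "filterlim (\<lambda>n. nat \<lceil>a * log_ratio n\<rceil>) at_top at_top"
proof -
  have "filterlim (\<lambda>n. a * log_ratio n) at_top at_top"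
    using assms log_ratio_at_top by (intro filterlim_tendsto_pos_mult_at_top[OF tendsto_const])
  then have ev: "eventually (\<lambda>n. real Z \<le> a * log_ratio n) at_top" for Z
    by (simp add: filterlim_at_top)
  show ?thesis unfolding filterlim_at_top
  proof
    fix Z :: nat
    show "eventually (\<lambda>n. Z \<le> nat \<lceil>a * log_ratio n\<rceil>) at_top"
      using ev[of Z] by eventually_elim linarith
  qed
qed

text \<open>After subtracting the constant for inner degrees, \<open>m n\<close> is still at least
  6/5 L, enough to beat the factor n that tree-like sets cost.\<close>

lemma no_large_degree_sum_on_small_trees:
  assumes c: "c > 0"
  shows "(\<lambda>n. Gnp_prob n (c / real n) (\<lambda>E. \<exists>T\<subseteq>{..<n}. T \<noteq> {} \<and> card T \<le> t0 \<and>
      card T \<le> card (inner_edges E T) + 1 \<and> 5/4 * log_ratio n \<le> real (\<Sum>v\<in>T. degree E v))) \<longlonglongrightarrow> 0"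
    (is "?f \<longlonglongrightarrow> 0")
proof (rule Lim_null_comparison)
  define m where "m n = nat \<lceil>5/4 * log_ratio n\<rceil> - t0\<^sup>2" for n
  define K where "K = real t0 * ((1 + c) ^ t0 * 2 ^ (t0\<^sup>2))"
  have "eventually (\<lambda>n. 6/5 * log_ratio n \<le> 5/4 * log_ratio n - real (t0\<^sup>2)) at_top"
    unfolding log_ratio_def by real_asymp
  then have ev: "eventually (\<lambda>n. 6/5 * log_ratio n \<le> real (m n)) at_top"
  proof eventually_elim
    case (elim n)
    then show ?case unfolding m_def by linarith
  qed
  have "K \<ge> 0" using c by (simp add: K_def)
  \<comment> \<open>The summand 1 makes the base positive also for \<open>t0 = 0\<close>.\<close>
  have "(\<lambda>n. real n * (t0 * c + 1) ^ m n / fact (m n)) \<longlonglongrightarrow> 0"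
    using c by (intro mult_power_div_fact_tendsto_0 ev) (simp add: add_nonneg_pos)
  from tendsto_mult_right_zero[OF this, of K]
  show "(\<lambda>n. K * (real n * (t0 * c + 1) ^ m n / fact (m n))) \<longlonglongrightarrow> 0" .
  have "eventually (\<lambda>n. c \<le> real n) at_top" by real_asymp
  moreover have "eventually (\<lambda>n. real (t0\<^sup>2) \<le> 5/4 * log_ratio n) at_top"
    unfolding log_ratio_def by real_asymp
  ultimately show "eventually (\<lambda>n. norm (?f n) \<le> K * (real n * (t0 * c + 1) ^ m n / fact (m n))) at_top"
    using eventually_gt_at_top[of 0]
  proof eventually_elim
    case (elim n)
    have "norm (?f n) = ?f n" using Gnp_prob_nonneg[of n c] elim c by simp
    also have "?f n \<le> Gnp_prob n (c / real n) (\<lambda>E. \<exists>T\<subseteq>{..<n}. T \<noteq> {} \<and> card T \<le> t0 \<and> card T \<le> card (inner_edges E T) + 1 \<and>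
      m n + t0\<^sup>2 \<le> (\<Sum>v\<in>T. degree E v))"
    proof (intro Gnp_prob_mono)
      fix E
      assume "\<exists>T\<subseteq>{..<n}. T \<noteq> {} \<and> card T \<le> t0 \<and>
        card T \<le> card (inner_edges E T) + 1 \<and> 5/4 * log_ratio n \<le> real (\<Sum>v\<in>T. degree E v)"
      then obtain T where T: "T \<subseteq> {..<n}" "T \<noteq> {}" "card T \<le> t0"
        "card T \<le> card (inner_edges E T) + 1" "5/4 * log_ratio n \<le> real (\<Sum>v\<in>T. degree E v)" by blast
      have "nat \<lceil>5/4 * log_ratio n\<rceil> \<le> (\<Sum>v\<in>T. degree E v)"
        using T(5) by (simp only: nat_le_iff ceiling_le_iff of_int_of_nat_eq)
      moreover have "t0\<^sup>2 \<le> nat \<lceil>5/4 * log_ratio n\<rceil>" using elim(2) by linarith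
      ultimately have "m n + t0\<^sup>2 \<le> (\<Sum>v\<in>T. degree E v)" unfolding m_def by linarith
      then show "\<exists>T\<subseteq>{..<n}. T \<noteq> {} \<and> card T \<le> t0 \<and> card T \<le> card (inner_edges E T) + 1 \<and>
        m n + t0\<^sup>2 \<le> (\<Sum>v\<in>T. degree E v)" using T by blast
    qed (use elim c in auto)
    also have "\<dots> \<le> real t0 * (real n ^ 1 * ((1 + c) ^ t0 * 2 ^ (t0\<^sup>2) * ((t0 * c) ^ m n / fact (m n))))"
      using elim c by (intro Gnp_prob_dense_bound_Ex) auto
    also have "\<dots> = K * (real n * ((t0 * c) ^ m n / fact (m n)))" by (simp add: K_def)
    also have "\<dots> \<le> K * (real n * ((t0 * c + 1) ^ m n / fact (m n)))"
      using c \<open>K \<ge> 0\<close> by (intro mult_left_mono divide_right_mono power_mono) auto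
    finally show ?case by simp
  qed
qed

text \<open>With as many inner edges as vertices no power of n remains. Then the factorial of any
  \<open>m n\<close> tending to infinity suffices, so \<epsilon> may be arbitrarily small.\<close>

lemma no_large_degree_on_small_cycles:
  assumes c: "c > 0" and \<epsilon>: "\<epsilon> > 0"
  shows "(\<lambda>n. Gnp_prob n (c / real n) (\<lambda>E. \<exists>T\<subseteq>{..<n}. card T \<le> t0 \<and>
      card T \<le> card (inner_edges E T) \<and> (\<exists>v\<in>T. \<epsilon> * log_ratio n \<le> real (degree E v)))) \<longlonglongrightarrow> 0"
    (is "?f \<longlonglongrightarrow> 0")
proof (rule Lim_null_comparison)
  define m where "m n = nat \<lceil>\<epsilon> * log_ratio n\<rceil> - t0\<^sup>2" for n
  define K where "K = real t0 * ((1 + c) ^ t0 * 2 ^ (t0\<^sup>2))"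
  have lim: "filterlim (\<lambda>n. nat \<lceil>\<epsilon> * log_ratio n\<rceil>) at_top at_top" by (rule large_nat_ceiling[OF \<epsilon>])
  have "filterlim m at_top at_top" unfolding m_def
    by (rule filterlim_compose[OF filterlim_minus_const_nat_at_top lim])
  from tendsto_mult_right_zero[OF power_div_fact_tendsto_0[OF this], of K "t0 * c"]
  show "(\<lambda>n. K * ((t0 * c) ^ m n / fact (m n))) \<longlonglongrightarrow> 0" .
  have "eventually (\<lambda>n. c \<le> real n) at_top" by real_asymp
  moreover have "eventually (\<lambda>n. t0\<^sup>2 \<le> nat \<lceil>\<epsilon> * log_ratio n\<rceil>) at_top"
    using lim by (simp add: filterlim_at_top)
  ultimately show "eventually (\<lambda>n. norm (?f n) \<le> K * ((t0 * c) ^ m n / fact (m n))) at_top"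
    using eventually_gt_at_top[of 0]
  proof eventually_elim
    case (elim n)
    have "norm (?f n) = ?f n" using Gnp_prob_nonneg[of n c] elim c by simp
    also have "?f n \<le> Gnp_prob n (c / real n) (\<lambda>E. \<exists>T\<subseteq>{..<n}. T \<noteq> {} \<and> card T \<le> t0 \<and> card T \<le> card (inner_edges E T) + 0 \<and>
      m n + t0\<^sup>2 \<le> (\<Sum>v\<in>T. degree E v))"
    proof (intro Gnp_prob_mono)
      fix E
      assume "\<exists>T\<subseteq>{..<n}. card T \<le> t0 \<and>
        card T \<le> card (inner_edges E T) \<and> (\<exists>v\<in>T. \<epsilon> * log_ratio n \<le> real (degree E v))"
      then obtain T v where T: "T \<subseteq> {..<n}" "card T \<le> t0"
        "card T \<le> card (inner_edges E T)" "v \<in> T" "\<epsilon> * log_ratio n \<le> real (degree E v)" by blast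
      have "finite T" using T finite_subset by auto
      have "nat \<lceil>\<epsilon> * log_ratio n\<rceil> \<le> degree E v"
        using T(5) by (simp only: nat_le_iff ceiling_le_iff of_int_of_nat_eq)
      also have "\<dots> \<le> (\<Sum>v\<in>T. degree E v)" using \<open>finite T\<close> T(4) by (intro member_le_sum) auto
      finally have "m n + t0\<^sup>2 \<le> (\<Sum>v\<in>T. degree E v)" using elim unfolding m_def by linarith
      then show "\<exists>T\<subseteq>{..<n}. T \<noteq> {} \<and> card T \<le> t0 \<and> card T \<le> card (inner_edges E T) + 0 \<and>
        m n + t0\<^sup>2 \<le> (\<Sum>v\<in>T. degree E v)" using T by auto
    qed (use elim c in auto)
    also have "\<dots> \<le> real t0 * (real n ^ 0 * ((1 + c) ^ t0 * 2 ^ (t0\<^sup>2) * ((t0 * c) ^ m n / fact (m n))))"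
      using elim c by (intro Gnp_prob_dense_bound_Ex) auto
    also have "\<dots> = K * ((t0 * c) ^ m n / fact (m n))" by (simp add: K_def)
    finally show ?case .
  qed
qed

text \<open>Half of the vertices serve as centers of independent stars into the other half. The
  expected number of stars of size about 5/6 L is at least a constant times exp (ln n - 9/10 L (ln L
  + O(1))), which tends to infinity because 9/10 < 1.\<close>

lemma max_degree_large:
  assumes c: "c > 0"
  shows "(\<lambda>n. Gnp_prob n (c / real n) (\<lambda>E. real (max_degree n E) < 5/6 * log_ratio n)) \<longlonglongrightarrow> 0"
    (is "?f \<longlonglongrightarrow> 0")
proof (rule Lim_null_comparison)
  \<comment> \<open>9/10 lies between 5/6 and 1: it absorbs rounding the star size up and still
    leaves the exponent growing.\<close>
  let ?y = "\<lambda>n. 9/10 * log_ratio n"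
  \<comment> \<open>Eventually a lower bound for (1 - c / n) ^ n, which tends to exp (- c): the
    probability that the other pairs of a star are absent.\<close>
  define \<kappa> where "\<kappa> = exp (- c) / 2"
  \<comment> \<open>From (c / (2 s)) ^ s, where the 2 is due to the other half having at least n / 2
    vertices. The absolute value keeps the factors nonnegative when \<open>s n\<close> is replaced
    by its upper bound.\<close>
  define C where "C = \<bar>ln (2 / c)\<bar>"
  define s where "s n = nat \<lceil>5/6 * log_ratio n\<rceil>" for n
  have \<kappa>: "\<kappa> > 0" by (simp add: \<kappa>_def)
  have "C \<ge> 0" by (simp add: C_def)
  show "(\<lambda>n. exp (- (\<kappa> / 3 * exp (ln (real n) - ?y n * (ln (?y n) + C))))) \<longlonglongrightarrow> 0"
    unfolding log_ratio_def using \<kappa> by real_asymp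
  have "(\<lambda>n. (1 + (- c) / real n) ^ n) \<longlonglongrightarrow> exp (- c)" by (rule tendsto_exp_limit_sequentially)
  moreover have "\<kappa> < exp (- c)" by (simp add: \<kappa>_def)
  ultimately have "eventually (\<lambda>n. \<kappa> < (1 + (- c) / real n) ^ n) at_top" by (rule order_tendstoD)
  moreover have "eventually (\<lambda>n. c \<le> real n) at_top" by real_asymp
  moreover have "eventually (\<lambda>n. 5/6 * log_ratio n + 1 \<le> ?y n) at_top" unfolding log_ratio_def by real_asymp
  moreover have "eventually (\<lambda>n. 1 \<le> 5/6 * log_ratio n) at_top" unfolding log_ratio_def by real_asymp
  moreover have "eventually (\<lambda>n. ?y n \<le> real n / 2) at_top" unfolding log_ratio_def by real_asymp
  ultimately show "eventually (\<lambda>n. norm (?f n) \<le> exp (- (\<kappa> / 3 * exp (ln (real n) - ?y n * (ln (?y n) + C))))) at_top"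
    using eventually_gt_at_top[of 3]
  proof eventually_elim
    case (elim n)
    define h where "h = n div 2"
    define N where "N = n - h"
    define p where "p = c / real n"
    have n: "n > 0" "real n > 0" using elim by auto
    have p: "0 \<le> p" "p \<le> 1" using elim c by (auto simp: p_def)
    have hn: "h \<le> n" "real n / 3 \<le> real h" "real n / 2 \<le> real N"
      using elim by (auto simp: h_def N_def real_of_nat_div)
    have s: "1 \<le> s n" "real (s n) \<le> ?y n" using elim unfolding s_def by linarith+
    have sN: "s n \<le> N" using s elim hn by linarith
    define q where "q = real (N choose s n) * p ^ s n * (1 - p) ^ (N - s n)"
    have q: "\<kappa> * exp (- (?y n * (ln (?y n) + C))) \<le> q"
    proof -
      have "ln (real (s n)) \<le> ln (?y n)" using s by simp
      moreover have "0 \<le> ln (real (s n))" using s by simp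
      ultimately have "real (s n) * (ln (real (s n)) + C) \<le> ?y n * (ln (?y n) + C)"
        using s \<open>C \<ge> 0\<close> by (intro mult_mono) auto
      moreover have "real (s n) * (ln (real (s n)) + ln (2 / c)) \<le> real (s n) * (ln (real (s n)) + C)"
        by (intro mult_left_mono) (auto simp: C_def)
      ultimately have "- (?y n * (ln (?y n) + C)) \<le> - (real (s n) * (ln (real (s n)) + ln (2 / c)))"
        by linarith
      then have "exp (- (?y n * (ln (?y n) + C))) \<le> exp (real (s n) * - (ln (real (s n)) + ln (2 / c)))"
        unfolding exp_le_cancel_iff mult_minus_right .
      also have "\<dots> = exp (- (ln (real (s n)) + ln (2 / c))) ^ s n" by (rule exp_of_nat_mult)
      also have "exp (- (ln (real (s n)) + ln (2 / c))) = c / (2 * real (s n))"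
      proof -
        have "exp (ln (real (s n)) + ln (2 / c)) = real (s n) * (2 / c)" using s c by (simp add: exp_add)
        then show ?thesis unfolding exp_minus by (simp add: field_simps)
      qed
      also have "\<dots> ^ s n \<le> (real N / real (s n) * p) ^ s n"
      proof (rule power_mono)
        have "c / (2 * real (s n)) = (real n / 2) / real (s n) * p" using n by (simp add: p_def)
        also have "\<dots> \<le> real N / real (s n) * p"
          using hn p by (intro mult_right_mono divide_right_mono) auto
        finally show "c / (2 * real (s n)) \<le> real N / real (s n) * p" .
      qed (use c in auto)
      also have "\<dots> = (real N / real (s n)) ^ s n * p ^ s n" by (rule power_mult_distrib)
      also have "\<dots> \<le> real (N choose s n) * p ^ s n"
        using binomial_ge_n_over_k_pow_k[OF sN, where 'a=real] p by (intro mult_right_mono) auto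
      finally have 1: "exp (- (?y n * (ln (?y n) + C))) \<le> real (N choose s n) * p ^ s n" .
      have "\<kappa> \<le> (1 - p) ^ n" using elim(1) by (simp add: p_def)
      also have "\<dots> \<le> (1 - p) ^ (N - s n)" using p by (intro power_decreasing) (auto simp: N_def)
      finally have "exp (- (?y n * (ln (?y n) + C))) * \<kappa> \<le> q" unfolding q_def
        using 1 \<kappa> p by (intro mult_mono) auto
      then show ?thesis by (simp add: mult.commute)
    qed
    have "norm (?f n) = ?f n" using Gnp_prob_nonneg[of n c] elim c n by simp
    also have "?f n \<le> Gnp_prob n (c / real n) (\<lambda>E. \<forall>v<h. degree E v < s n)"
    proof (intro Gnp_prob_mono allI impI)
      fix E v assume E: "E \<subseteq> all_edges n" "real (max_degree n E) < 5/6 * log_ratio n" and v: "v < h"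
      have "degree E v \<le> max_degree n E" using degree_le_max_degree[OF E(1), of v] v hn by simp
      then have "real (degree E v) < 5/6 * log_ratio n" using E by linarith
      then show "degree E v < s n" unfolding s_def by linarith
    qed (use elim c in auto)
    also have "\<dots> \<le> (1 - q) ^ h"
      using prob_max_degree_less[OF p hn(1), of "s n"] by (simp add: p_def q_def N_def)
    also have "\<dots> \<le> exp (- q) ^ h"
    proof (rule power_mono)
      show "1 - q \<le> exp (- q)" using exp_ge_add_one_self[of "- q"] by simp
      \<comment> \<open>Raising 1 - q \<le> exp (- q) to a power requires q \<le> 1, which holds
        because \<open>q\<close> is itself a binomial probability.\<close>
      have "q = edge_prob p {..<N} (\<lambda>E. card E = s n)" by (simp add: edge_prob_card q_def)
      then show "0 \<le> 1 - q" using edge_prob_le_1[OF p, of "{..<N}"] by simp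
    qed
    also have "\<dots> = exp (- (q * real h))" by (simp add: exp_of_nat_mult[symmetric] mult.commute)
    also have "\<dots> \<le> exp (- (\<kappa> / 3 * exp (ln (real n) - ?y n * (ln (?y n) + C))))"
    proof -
      have "\<kappa> / 3 * exp (ln (real n) - ?y n * (ln (?y n) + C))
        = (\<kappa> * exp (- (?y n * (ln (?y n) + C)))) * (real n / 3)"
      proof -
        have "exp (ln (real n) - z) = exp (- z) * real n" for z
          using n exp_add[of "- z" "ln (real n)"] by simp
        then show ?thesis by simp
      qed
      also have "\<dots> \<le> q * real h"
        using q hn \<kappa> order.trans[OF _ q, of 0] by (intro mult_mono) auto
      finally show ?thesis by simp
    qed
    finally show ?case .
  qed
qed

section \<open>Bounded degeneracy\<close>

lemma sum_degree_le_inner_edges: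
  assumes E: "E \<subseteq> all_edges n" and W: "W \<subseteq> {..<n}"
  shows "(\<Sum>v\<in>W. card {u\<in>W. adj E v u}) \<le> 2 * card (inner_edges E W)"
proof -
  have fin: "finite W" using W finite_subset by auto
  let ?A = "{(v,u). v \<in> W \<and> u \<in> W \<and> adj E v u \<and> v < u}"
  let ?B = "{(v,u). v \<in> W \<and> u \<in> W \<and> adj E v u \<and> u < v}"
  have fAB: "finite ?A" "finite ?B" using fin by (auto intro: finite_subset[of _ "W \<times> W"])
  have pair: "{v,u} \<in> inner_edges E W" if "v \<in> W" "u \<in> W" "adj E v u" for v u
    using that by (simp add: inner_edges_def adj_def)
  have "card ?A \<le> card (inner_edges E W)"
  proof (rule card_inj_on_le[of "\<lambda>(v,u). {v,u}"])
    show "inj_on (\<lambda>(v,u). {v,u}) ?A" by (auto simp: inj_on_def doubleton_eq_iff)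
    show "(\<lambda>(v,u). {v,u}) ` ?A \<subseteq> inner_edges E W" using pair by auto
  qed (rule finite_inner_edges[OF fin])
  moreover have "card ?B \<le> card (inner_edges E W)"
  proof (rule card_inj_on_le[of "\<lambda>(v,u). {v,u}"])
    show "inj_on (\<lambda>(v,u). {v,u}) ?B" by (auto simp: inj_on_def doubleton_eq_iff)
    show "(\<lambda>(v,u). {v,u}) ` ?B \<subseteq> inner_edges E W" using pair by auto
  qed (rule finite_inner_edges[OF fin])
  moreover have "(SIGMA v:W. {u\<in>W. adj E v u}) = ?A \<union> ?B"
    by (auto simp: adj_def dest: linorder_neqE_nat)
  then have "(\<Sum>v\<in>W. card {u\<in>W. adj E v u}) = card (?A \<union> ?B)"
    using fin card_SigmaI[of W "\<lambda>v. {u\<in>W. adj E v u}"] by simp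
  ultimately show ?thesis using card_Un_le[of ?A ?B] by linarith
qed

text \<open>With y = s / n, the s-th root of the left side is at most (e / y) * (e c y / a) ^ a, and
  this is at most y / 2. In (y / 2) ^ s one factor y provides 1 / n, and the powers of 2 make the
  sum over all sizes converge.\<close>

lemma dense_subgraph_bound:
  assumes a: "a \<ge> 2" "4 * exp 1 * c \<le> real a" and c: "c > 0" and s: "1 \<le> s" "s \<le> n"
  shows "real (n choose s) * real (s\<^sup>2 choose (a * s)) * (c / real n) ^ (a * s) \<le> real s / 2 ^ s / real n"
proof -
  let ?e = "exp 1 :: real"
  define y where "y = real s / real n"
  have y: "0 < y" "y \<le> 1" using s by (auto simp: y_def)
  have n: "real n > 0" and s0: "real s > 0" using s by auto
  have "real (n choose s) \<le> (?e * real n / real s) ^ s"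
    using binomial_le_power_div_fact[of n s] power_div_fact_le[of "real n" s] s by simp
  moreover have "real (s\<^sup>2 choose (a * s)) \<le> (?e * real (s\<^sup>2) / real (a * s)) ^ (a * s)"
    using binomial_le_power_div_fact[of "s\<^sup>2" "a * s"] power_div_fact_le[of "real (s\<^sup>2)" "a * s"] s a by simp
  ultimately have "real (n choose s) * real (s\<^sup>2 choose (a * s)) * (c / real n) ^ (a * s)
     \<le> (?e * real n / real s) ^ s * (?e * real (s\<^sup>2) / real (a * s)) ^ (a * s) * (c / real n) ^ (a * s)"
    using c n by (intro mult_right_mono mult_mono) auto
  also have "\<dots> = (?e * real n / real s * (?e * real (s\<^sup>2) / real (a * s) * (c / real n)) ^ a) ^ s"
  proof -
    have "X ^ s * Y ^ (a * s) * Z ^ (a * s) = (X * (Y * Z) ^ a) ^ s" for X Y Z :: real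
      by (simp add: power_mult power_mult_distrib)
    then show ?thesis .
  qed
  also have "?e * real (s\<^sup>2) / real (a * s) * (c / real n) = ?e * c / real a * y"
    using s0 n a by (simp add: y_def power2_eq_square field_simps)
  also have "?e * real n / real s = ?e / y" by (simp add: y_def)
  also have "(?e / y * (?e * c / real a * y) ^ a) ^ s \<le> (y / 2) ^ s"
  proof (rule power_mono)
    have "?e * c / real a \<le> 1 / 4" using a c by (simp add: field_simps)
    then have le: "?e * c / real a * y \<le> 1 / 4 * y" using y by (intro mult_right_mono) auto
    have "(?e * c / real a * y) ^ a \<le> (1 / 4 * y) ^ a" using le c y by (intro power_mono) auto
    \<comment> \<open>Since a \<ge> 2, two powers of y are available: one cancels the 1 / y from
      choosing the vertex set, the other survives.\<close>
    also have "\<dots> \<le> (1 / 4 * y) ^ 2" using a y by (intro power_decreasing) auto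
    finally have "?e / y * (?e * c / real a * y) ^ a \<le> ?e / y * (1 / 4 * y) ^ 2"
      using y by (intro mult_left_mono) auto
    also have "\<dots> = ?e * y / 16" using y by (simp add: power2_eq_square)
    also have "\<dots> \<le> y / 2" using exp_le y by (simp add: mult_right_mono)
    finally show "?e / y * (?e * c / real a * y) ^ a \<le> y / 2" .
  qed (use y c in auto)
  also have "\<dots> = y ^ s / 2 ^ s" by (rule power_divide)
  also have "\<dots> \<le> y / 2 ^ s"
    using power_decreasing[of 1 s y] y s by (intro divide_right_mono) auto
  finally show ?thesis by (simp add: y_def mult.commute)
qed

lemma sum_div_power2_le: "(\<Sum>s\<in>{1..n}. real s / 2 ^ s) \<le> 2"
proof -
  have "(\<Sum>s\<in>{1..n}. real s / 2 ^ s) = 2 - (real n + 2) / 2 ^ n"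
    by (induction n) (auto simp: field_simps)
  then show ?thesis by simp
qed

text \<open>A set in which all inner degrees exceed \<open>2 * a\<close> spans at least
  \<open>a\<close> times as many edges as it has vertices. Summing over all sizes gives at most 2 /
  n.\<close>

lemma not_degenerate_tendsto_0:
  assumes a: "a \<ge> 2" "4 * exp 1 * c \<le> real a" and c: "c > 0"
  shows "(\<lambda>n. Gnp_prob n (c / real n)
    (\<lambda>E. \<exists>W\<subseteq>{..<n}. W \<noteq> {} \<and> (\<forall>v\<in>W. 2 * a < card {u\<in>W. adj E v u}))) \<longlonglongrightarrow> 0"
    (is "?f \<longlonglongrightarrow> 0")
proof (rule Lim_null_comparison)
  show "(\<lambda>n. 2 / real n) \<longlonglongrightarrow> 0" by real_asymp
  have "eventually (\<lambda>n. c \<le> real n) at_top" by real_asymp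
  then show "eventually (\<lambda>n. norm (?f n) \<le> 2 / real n) at_top"
    using eventually_gt_at_top[of 0]
  proof eventually_elim
    case (elim n)
    let ?p = "c / real n"
    have p: "0 \<le> ?p" "?p \<le> 1" using elim c by auto
    let ?Q = "\<lambda>s E. \<exists>U\<subseteq>{..<n}. card U = s \<and> a * s \<le> card (inner_edges E U)"
    have "norm (?f n) = ?f n" using Gnp_prob_nonneg[of n c] elim c by simp
    also have "?f n \<le> (\<Sum>s\<in>{1..n}. Gnp_prob n ?p (?Q s))"
      unfolding Gnp_prob_conv
    proof (rule edge_prob_union_bound[OF p finite_all_edges])
      fix E assume E: "E \<subseteq> all_edges n"
        and "\<exists>W\<subseteq>{..<n}. W \<noteq> {} \<and> (\<forall>v\<in>W. 2 * a < card {u\<in>W. adj E v u})"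
      then obtain W where W: "W \<subseteq> {..<n}" "W \<noteq> {}" "\<And>v. v \<in> W \<Longrightarrow> 2 * a < card {u\<in>W. adj E v u}" by blast
      have fin: "finite W" using W finite_subset by auto
      have "card W \<le> n" using card_mono[OF _ W(1)] by simp
      then have 1: "card W \<in> {1..n}" using fin W(2) by (simp add: Suc_le_eq card_gt_0_iff)
      have "2 * a * card W = (\<Sum>v\<in>W. 2 * a)" by simp
      also have "\<dots> \<le> (\<Sum>v\<in>W. card {u\<in>W. adj E v u})" using W(3) by (intro sum_mono less_imp_le)
      also have "\<dots> \<le> 2 * card (inner_edges E W)" by (rule sum_degree_le_inner_edges[OF E W(1)])
      finally have "a * card W \<le> card (inner_edges E W)" by simp
      then show "\<exists>s\<in>{1..n}. ?Q s E" using 1 W(1) by blast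
    qed simp
    also have "\<dots> \<le> (\<Sum>s\<in>{1..n}. real s / 2 ^ s / real n)"
    proof (rule sum_mono)
      fix s assume s: "s \<in> {1..n}"
      show "Gnp_prob n ?p (?Q s) \<le> real s / 2 ^ s / real n"
        using prob_dense[OF p, of n s "a * s"] dense_subgraph_bound[OF a c, of s n] s by auto
    qed
    also have "\<dots> = (\<Sum>s\<in>{1..n}. real s / 2 ^ s) / real n" by (rule sum_divide_distrib[symmetric])
    also have "\<dots> \<le> 2 / real n" using sum_div_power2_le by (intro divide_right_mono) auto
    finally show ?case .
  qed
qed

theorem theorem2:
  fixes c :: real
  assumes "c > 0"
  shows "(\<lambda>n. Gnp_prob n (c / real n)
            (\<lambda>E. int (tau 2 n E) =
                 \<lceil>(sqrt (8 * real (max_degree n E) + 1) + 5) / 2\<rceil>))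
         \<longlonglongrightarrow> 1"
    (is "(\<lambda>n. Gnp_prob n _ (?good n)) \<longlonglongrightarrow> 1")
proof -
  \<comment> \<open>4 e c makes the ratio e c / a at most 1/4 in
    \<open>dense_subgraph_bound\<close>, and 2 is the least exponent that works there.\<close>
  define a where "a = max 2 (nat \<lceil>4 * exp 1 * c\<rceil>)"
  have a: "a \<ge> 2" "4 * exp 1 * c \<le> real a" unfolding a_def by linarith+
  define d where "d = 2 * a"
  \<comment> \<open>Chosen so that d \<epsilon> = 1/100; then \<open>R = 250 * a\<close> gives R
    \<epsilon> = 5/4. All constants, including \<open>k0\<close> below, depend on \<open>c\<close>
    only, so \<open>n\<close> can be taken large afterwards.\<close>
  define \<epsilon> where "\<epsilon> = 1 / (200 * real a)"
  define R where "R = 250 * a"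
  have \<epsilon>: "\<epsilon> > 0" "5/4 \<le> real (R + 1) * \<epsilon>" "real d * \<epsilon> \<le> 1/100"
    using a by (auto simp: \<epsilon>_def R_def d_def field_simps)
  obtain k0 where k0: "\<And>k. k0 \<le> k \<Longrightarrow> R + R * R < (k - 2 * (R + R * R)) choose 2"
      "\<And>k. k0 \<le> k \<Longrightarrow> 39/50 * real ((k - 2) choose 2) + real R < real ((k - 2 * (R + d)) choose 2)"
    using many_labels[of "R + R * R" R "R + d"] by blast
  define B1 where "B1 n E \<longleftrightarrow> (\<exists>T\<subseteq>{..<n}. T \<noteq> {} \<and> card T \<le> 8 * (R + 1) \<and>
      card T \<le> card (inner_edges E T) + 1 \<and> 5/4 * log_ratio n \<le> real (\<Sum>v\<in>T. degree E v))" for n E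
  define B2 where "B2 n E \<longleftrightarrow> (\<exists>T\<subseteq>{..<n}. card T \<le> 8 * (R + 1) \<and>
      card T \<le> card (inner_edges E T) \<and> (\<exists>v\<in>T. \<epsilon> * log_ratio n \<le> real (degree E v)))" for n E
  define B3 where "B3 n E \<longleftrightarrow> real (max_degree n E) < 5/6 * log_ratio n" for n E
  define B4 where "B4 n E \<longleftrightarrow> (\<exists>W\<subseteq>{..<n}. W \<noteq> {} \<and> (\<forall>v\<in>W. d < card {u\<in>W. adj E v u}))" for n E
  let ?P = "\<lambda>n B. Gnp_prob n (c / real n) (B n)"
  have "(\<lambda>n. ?P n B1) \<longlonglongrightarrow> 0" unfolding B1_def using assms by (rule no_large_degree_sum_on_small_trees)
  moreover have "(\<lambda>n. ?P n B2) \<longlonglongrightarrow> 0" unfolding B2_def using assms \<epsilon>(1) by (rule no_large_degree_on_small_cycles)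
  moreover have "(\<lambda>n. ?P n B3) \<longlonglongrightarrow> 0" unfolding B3_def using assms by (rule max_degree_large)
  moreover have "(\<lambda>n. ?P n B4) \<longlonglongrightarrow> 0" unfolding B4_def d_def using a assms by (rule not_degenerate_tendsto_0)
  ultimately have "(\<lambda>n. 1 - (?P n B1 + ?P n B2 + ?P n B3 + ?P n B4)) \<longlonglongrightarrow> 1 - (0 + 0 + 0 + 0)"
    by (intro tendsto_intros)
  then have lower: "(\<lambda>n. 1 - (?P n B1 + ?P n B2 + ?P n B3 + ?P n B4)) \<longlonglongrightarrow> 1" by simp
  have "eventually (\<lambda>n. c \<le> real n) at_top" by real_asymp
  moreover have "eventually (\<lambda>n. real (k0\<^sup>2 + 1) \<le> 5/6 * log_ratio n) at_top"
    unfolding log_ratio_def by real_asymp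
  ultimately have ev: "eventually (\<lambda>n. 1 - (?P n B1 + ?P n B2 + ?P n B3 + ?P n B4) \<le> ?P n ?good \<and> ?P n ?good \<le> 1) at_top"
    using eventually_gt_at_top[of 0]
  proof eventually_elim
    case (elim n)
    have p: "0 \<le> c / real n" "c / real n \<le> 1" using elim assms by auto
    have L: "log_ratio n > 0" using elim(2) by linarith
    have "?good n E" if E: "E \<subseteq> all_edges n" and nB: "\<not> B1 n E" "\<not> B2 n E" "\<not> B3 n E" "\<not> B4 n E" for E
    proof -
      have "sparse_graph E n R d (log_ratio n) \<epsilon>"
      proof
        fix T assume T: "T \<subseteq> {..<n}" "card T \<le> 8 * (R + 1)" "card T \<le> card (inner_edges E T) + 1"
        show "real (\<Sum>v\<in>T. degree E v) < 5/4 * log_ratio n"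
        \<comment> \<open>\<open>B1\<close> speaks of nonempty sets only; the empty set has degree
          sum 0, which is below 5/4 L because L is positive.\<close>
        proof (cases "T = {}")
          case True
          then show ?thesis using L by simp
        next
          case False
          then show ?thesis using nB(1) T unfolding B1_def by (meson not_le)
        qed
      next
        fix T v assume "T \<subseteq> {..<n}" "card T \<le> 8 * (R + 1)" "card T \<le> card (inner_edges E T)" "v \<in> T"
        then show "real (degree E v) < \<epsilon> * log_ratio n" using nB(2) unfolding B2_def by (meson not_le)
      next
        fix W assume "W \<subseteq> {..<n}" "W \<noteq> {}"
        then show "\<exists>v\<in>W. card {u\<in>W. adj E v u} \<le> d" using nB(4) unfolding B4_def by (meson not_le)
      qed (use E L \<epsilon> nB(3) in \<open>auto simp: B3_def\<close>)
      then interpret sparse_graph E n R d "log_ratio n" \<epsilon> .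
      show ?thesis using tau_eq[of k0] k0 elim by simp
    qed
    then have "Gnp_prob n (c / real n) (\<lambda>E. \<not> ?good n E) \<le>
        Gnp_prob n (c / real n) (\<lambda>E. ((B1 n E \<or> B2 n E) \<or> B3 n E) \<or> B4 n E)"
      using elim assms by (intro Gnp_prob_mono) auto
    also have "\<dots> \<le> ?P n B1 + ?P n B2 + ?P n B3 + ?P n B4"
      unfolding Gnp_prob_conv
      by (intro order.trans[OF edge_prob_disj[OF p finite_all_edges]] add_mono order.refl)
    finally have "1 - ?P n ?good \<le> ?P n B1 + ?P n B2 + ?P n B3 + ?P n B4"
      by (simp only: Gnp_prob_conv edge_prob_not[OF p finite_all_edges])
    moreover have "?P n ?good \<le> 1" unfolding Gnp_prob_conv by (rule edge_prob_le_1[OF p finite_all_edges])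
    ultimately show ?case by linarith
  qed
  show ?thesis
    by (rule tendsto_sandwich[OF _ _ lower tendsto_const])
      (use ev in \<open>auto elim: eventually_mono\<close>)
qed

end
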